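(* Let $X=\{X(t)\}_{t\ge0}$ be a continuous-time Markov chain on a finite or countably infinite state space $I$ with infinitesimal generator $Q=\{q(i,j)\}_{i,j\in I}$ satisfying $\sup_{i\in I}|q(i,i)|<\infty$, and with initial distribution $\rho=\{\rho(i)\}_{i\in I}=\{\mathbb{P}(X(0)=i)\}_{i\in I}$. Let $X_1,\dots,X_N$ be $N\ge1$ independent and identically distributed realizations of $X$. Let $U_{\mathrm{T}}\subseteq I$ be a finite target set, and let $$S_N(t):=\bigcup_{n=1}^N\bigcup_{s\in[0,t]}\{X_n(s)\},\qquad \sigma_N:=\inf\{t>0:U_{\mathrm{T}}\subseteq S_N(t)\}$$ be, respectively, the set of states visited by at least one searcher by time $t$ and the cover time of $U_{\mathrm{T}}$. For $j\in I$ let $\tau_n(j):=\inf\{t>0:X_n(t)=j\}$ and $T_N(j):=\min\{\tau_1(j),\dots,\tau_N(j)\}$. Assume (i) $U_{\mathrm{T}}\not\subseteq\mathrm{supp}(\rho)$, where $\mathrm{supp}(\rho):=\{i\in I:\rho(i)>0\}$; and (ii) for each $j\in U_{\mathrm{T}}$, $\mathbb{E}[T_N(j)]<\infty$ for some $N\ge1$. Then for every $m\in(0,\infty)$, $$\mathbb{E}[\sigma_N^m]\sim\frac{K_m}{N^{m/d}}\quad\text{as }N\to\infty,$$ i.e. $N^{m/d}\mathbb{E}[\sigma_N^m]\to K_m$, where $d$ and $K_m$ are defined in the context below.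
   Context: The generator $Q$ has nonnegative off-diagonal entries $q(i,j)$ (the jump rate from $i$ to $j\neq i$) and nonpositive diagonal entries chosen so that each row sums to zero. A path of length $k\in\mathbb{Z}_{\ge0}$ is a sequence $\mathcal{P}=(\mathcal{P}(0),\dots,\mathcal{P}(k))\in I^{k+1}$ with $q(\mathcal{P}(j),\mathcal{P}(j+1))>0$ for all $j\in\{0,\dots,k-1\}$; its weight is $\lambda(\mathcal{P}):=\prod_{j=0}^{k-1}q(\mathcal{P}(j),\mathcal{P}(j+1))$. For $I_0,I_1\subseteq I$, let $d_{\min}(I_0,I_1):=\inf\{k:\ \text{there is a path }\mathcal{P}\in I^{k+1}\text{ with }\mathcal{P}(0)\in I_0,\ \mathcal{P}(k)\in I_1\}$ (the smallest number of jumps needed to go from $I_0$ to $I_1$), and let $\mathcal{S}(I_0,I_1)$ be the set of all paths $\mathcal{P}$ of length $k=d_{\min}(I_0,I_1)$ with $\mathcal{P}(0)\in I_0$ and $\mathcal{P}(k)\in I_1$. For $J\subseteq I$ define $$\Lambda(\rho,J):=\sum_{\mathcal{P}\in\mathcal{S}(\mathrm{supp}(\rho),J)}\rho(\mathcal{P}(0))\,\lambda(\mathcal{P}).$$ Define $d:=\sup_{j\in U_{\mathrm{T}}}d_{\min}(\mathrm{supp}(\rho),\{j\})\ge1$, the set $U_{\mathrm{T}}^{\mathrm{far}}:=\{j\in U_{\mathrm{T}}:d_{\min}(\mathrm{supp}(\rho),\{j\})=d\}$, and $$K_m:=\Gamma\Big(1+\frac{m}{d}\Big)\sum_{i=1}^{|U_{\mathrm{T}}^{\mathrm{far}}|}\bigg[(-1)^{i-1}\sum_{J\subseteq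 U_{\mathrm{T}}^{\mathrm{far}},\ |J|=i}\Big(\frac{d!}{\Lambda(\rho,J)}\Big)^{m/d}\bigg],$$ where the inner sum is over all subsets $J$ of $U_{\mathrm{T}}^{\mathrm{far}}$ of size $i$. Here $f\sim g$ means $f/g\to1$. *)

theory Defs
  imports "HOL-Probability.Probability"
begin

fun qpow :: "('i \<Rightarrow> 'i \<Rightarrow> real) \<Rightarrow> nat \<Rightarrow> 'i \<Rightarrow> 'i \<Rightarrow> real" where
  "qpow Q 0 i j = (if i = j then 1 else 0)"
| "qpow Q (Suc k) i j = (\<Sum>\<^sub>\<infinity>l. qpow Q k i l * Q l j)"

text \<open>Transition function P(t) = exp(tQ) (well defined since rates are bounded).\<close>
definition trans_fun :: "('i \<Rightarrow> 'i \<Rightarrow> real) \<Rightarrow> real \<Rightarrow> 'i \<Rightarrow> 'i \<Rightarrow> real" where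
  "trans_fun Q t i j = (\<Sum>k. t ^ k / fact k * qpow Q k i j)"

definition is_generator :: "('i \<Rightarrow> 'i \<Rightarrow> real) \<Rightarrow> bool" where
  "is_generator Q \<longleftrightarrow> (\<forall>i j. i \<noteq> j \<longrightarrow> Q i j \<ge> 0) \<and> (\<forall>i. ((\<lambda>j. Q i j) has_sum 0) UNIV)"

definition is_ctmc :: "'a measure \<Rightarrow> ('i \<Rightarrow> 'i \<Rightarrow> real) \<Rightarrow> ('i \<Rightarrow> real) \<Rightarrow> (real \<Rightarrow> 'a \<Rightarrow> 'i) \<Rightarrow> bool" where
  "is_ctmc M Q \<rho> Y \<longleftrightarrow>
     (\<forall>t. Y t \<in> measurable M (count_space UNIV)) \<and>
     (\<forall>\<omega>\<in>space M. \<forall>t\<ge>0. \<exists>\<epsilon>>0. \<forall>s. t \<le> s \<and> s < t + \<epsilon> \<longrightarrow> Y s \<omega> = Y t \<omega>) \<and>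
     (\<forall>k (tt::nat \<Rightarrow> real) (ii::nat \<Rightarrow> 'i). tt 0 = 0 \<and> (\<forall>l<k. tt l \<le> tt (Suc l)) \<longrightarrow>
        measure M {\<omega>\<in>space M. \<forall>l\<le>k. Y (tt l) \<omega> = ii l}
          = \<rho> (ii 0) * (\<Prod>l<k. trans_fun Q (tt (Suc l) - tt l) (ii l) (ii (Suc l))))"

definition is_path :: "('i \<Rightarrow> 'i \<Rightarrow> real) \<Rightarrow> 'i list \<Rightarrow> bool" where
  "is_path Q p \<longleftrightarrow> p \<noteq> [] \<and> (\<forall>l. Suc l < length p \<longrightarrow> Q (p ! l) (p ! Suc l) > 0)"

definition path_weight :: "('i \<Rightarrow> 'i \<Rightarrow> real) \<Rightarrow> 'i list \<Rightarrow> real" where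
  "path_weight Q p = (\<Prod>l<length p - 1. Q (p ! l) (p ! Suc l))"

definition dmin :: "('i \<Rightarrow> 'i \<Rightarrow> real) \<Rightarrow> 'i set \<Rightarrow> 'i set \<Rightarrow> enat" where
  "dmin Q I0 I1 = Inf {enat (length p - 1) | p. is_path Q p \<and> hd p \<in> I0 \<and> last p \<in> I1}"

definition min_paths :: "('i \<Rightarrow> 'i \<Rightarrow> real) \<Rightarrow> 'i set \<Rightarrow> 'i set \<Rightarrow> 'i list set" where
  "min_paths Q I0 I1 = {p. is_path Q p \<and> hd p \<in> I0 \<and> last p \<in> I1 \<and> enat (length p - 1) = dmin Q I0 I1}"

definition supp :: "('i \<Rightarrow> real) \<Rightarrow> 'i set" where
  "supp \<rho> = {i. \<rho> i > 0}"

definition Lambda :: "('i \<Rightarrow> 'i \<Rightarrow> real) \<Rightarrow> ('i \<Rightarrow> real) \<Rightarrow> 'i set \<Rightarrow> real" where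
  "Lambda Q \<rho> J = (\<Sum>\<^sub>\<infinity>p\<in>min_paths Q (supp \<rho>) J. \<rho> (hd p) * path_weight Q p)"

definition dd :: "('i \<Rightarrow> 'i \<Rightarrow> real) \<Rightarrow> ('i \<Rightarrow> real) \<Rightarrow> 'i set \<Rightarrow> nat" where
  "dd Q \<rho> U = the_enat (Sup ((\<lambda>j. dmin Q (supp \<rho>) {j}) ` U))"

definition far :: "('i \<Rightarrow> 'i \<Rightarrow> real) \<Rightarrow> ('i \<Rightarrow> real) \<Rightarrow> 'i set \<Rightarrow> 'i set" where
  "far Q \<rho> U = {j\<in>U. dmin Q (supp \<rho>) {j} = enat (dd Q \<rho> U)}"

definition Kconst :: "('i \<Rightarrow> 'i \<Rightarrow> real) \<Rightarrow> ('i \<Rightarrow> real) \<Rightarrow> 'i set \<Rightarrow> real \<Rightarrow> real" where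
  "Kconst Q \<rho> U m =
     (let d = dd Q \<rho> U; F = far Q \<rho> U in
      Gamma (1 + m / real d) *
      (\<Sum>i=1..card F. (-1) ^ (i - 1) *
         (\<Sum>J\<in>{J. J \<subseteq> F \<and> card J = i}. (fact d / Lambda Q \<rho> J) powr (m / real d))))"

text \<open>Searchers are indexed from 0: X_1,...,X_N correspond to X 0, ..., X (N-1).\<close>
definition visited :: "(nat \<Rightarrow> real \<Rightarrow> 'a \<Rightarrow> 'i) \<Rightarrow> nat \<Rightarrow> real \<Rightarrow> 'a \<Rightarrow> 'i set" where
  "visited X N t \<omega> = {X n s \<omega> | n s. n < N \<and> 0 \<le> s \<and> s \<le> t}"

definition cover_time :: "(nat \<Rightarrow> real \<Rightarrow> 'a \<Rightarrow> 'i) \<Rightarrow> 'i set \<Rightarrow> nat \<Rightarrow> 'a \<Rightarrow> ennreal" where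
  "cover_time X U N \<omega> = Inf {ennreal t | t. t > 0 \<and> U \<subseteq> visited X N t \<omega>}"

definition hit_time :: "(nat \<Rightarrow> real \<Rightarrow> 'a \<Rightarrow> 'i) \<Rightarrow> nat \<Rightarrow> 'i \<Rightarrow> 'a \<Rightarrow> ennreal" where
  "hit_time X n j \<omega> = Inf {ennreal t | t. t > 0 \<and> X n t \<omega> = j}"

definition fpt :: "(nat \<Rightarrow> real \<Rightarrow> 'a \<Rightarrow> 'i) \<Rightarrow> nat \<Rightarrow> 'i \<Rightarrow> 'a \<Rightarrow> ennreal" where
  "fpt X N j \<omega> = Inf {hit_time X n j \<omega> | n. n < N}"

definition enn_powr :: "ennreal \<Rightarrow> real \<Rightarrow> ennreal" where
  "enn_powr x m = (if x = \<top> then \<top> else ennreal (enn2real x powr m))"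

end

theory Submission
  imports Defs "HOL-Real_Asymp.Real_Asymp"
begin

text \<open>
  Write \<open>p = m / d\<close> and let \<open>G J t\<close> be the probability that a single searcher misses \<open>J\<close> up to
  time \<open>t\<close>. By independence and inclusion-exclusion,
  \<open>P (\<sigma> N > t) = (\<Sum>J. (-1) ^ (card J + 1) * G J t ^ N)\<close> over the nonempty \<open>J \<subseteq> U\<close>, so it
  suffices to find the asymptotics of the moments with survival function \<open>G J t ^ N\<close>.
  By a Laplace-type argument these are determined by the behaviour of \<open>1 - G J t\<close> as \<open>t\<close> tends
  to 0, finiteness of the mean of some \<open>T N j\<close> providing the polynomial tail needed for
  domination. For small \<open>t\<close> the probability \<open>1 - G J t\<close> of hitting \<open>J\<close> before \<open>t\<close> agrees to
  leading order with the probability of being in \<open>J\<close> at time \<open>t\<close>, since a chain that reached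
  \<open>J\<close> stays where it is up to \<open>t\<close> with probability close to 1. Expanding \<open>\<rho> exp (t Q)\<close>, the first
  nonzero coefficient has index \<open>e = dmin (supp \<rho>) J\<close> and, for \<open>J\<close> consisting of farthest targets,
  equals \<open>\<Lambda>(\<rho>, J) / e!\<close>. Sets with \<open>e < d\<close> contribute only \<open>o(N powr (- p))\<close>.
\<close>

section \<open>Powers of a bounded generator\<close>

text \<open>The chain is known only through its finite-dimensional distributions and right-constant
  paths, so the strong Markov property at a hitting time is not at hand. Hitting events are
  exhausted by dyadic grids instead: the first grid time in \<open>J\<close> takes finitely many
  values, and the product formula at deterministic times does the rest. As \<open>I\<close> may be
  infinite, matrix products are infinite sums; the bound on the rates makes all of them absolutely
  summable.

  The terms of inclusion-exclusion have signs, so each must be integrable by itself before the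
  integral can be split. One finite mean of \<open>T N j\<close> gives decay of order 1/t for a
  fixed power of \<open>G J t\<close>; further powers improve the order without limit, which is why
  every moment is finite for large \<open>N\<close>.

  In the variable u = t^d one has 1 - G ~ a u^\<theta> with \<theta> = e/d. After u = s/N the N-th
  power tends to exp(- a s) if \<theta> = 1 and to 0 if \<theta> < 1; hence the scale N^(-p), the
  factor \<open>Gamma (1 + p)\<close> and the restriction to farthest targets.\<close>

lemma abs_summable_kernel:
  fixes a :: "'a \<Rightarrow> real" and b :: "'a \<Rightarrow> 'b \<Rightarrow> real"
  assumes a: "(\<lambda>l. \<bar>a l\<bar>) summable_on UNIV"
    and b: "\<And>l. (\<lambda>j. \<bar>b l j\<bar>) summable_on UNIV" "\<And>l. (\<Sum>\<^sub>\<infinity>j. \<bar>b l j\<bar>) \<le> B"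
  shows abs_summable_kernel_prod: "(\<lambda>(l, j). \<bar>a l * b l j\<bar>) summable_on UNIV"
    and abs_summable_kernel_image: "(\<lambda>j. \<bar>\<Sum>\<^sub>\<infinity>l. a l * b l j\<bar>) summable_on UNIV"
    and abs_summable_kernel_column: "(\<lambda>l. \<bar>a l * b l j\<bar>) summable_on UNIV"
    and infsum_kernel_image_le:
      "(\<Sum>\<^sub>\<infinity>j. \<bar>\<Sum>\<^sub>\<infinity>l. a l * b l j\<bar>) \<le> B * (\<Sum>\<^sub>\<infinity>l. \<bar>a l\<bar>)"
proof -
  let ?h = "\<lambda>l j. \<bar>a l * b l j\<bar>"
  have inner: "(\<Sum>\<^sub>\<infinity>j. ?h l j) = \<bar>a l\<bar> * (\<Sum>\<^sub>\<infinity>j. \<bar>b l j\<bar>)" for l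
    using b(1)[of l] by (subst infsum_cmult_right[symmetric]) (auto simp: abs_mult)
  have inner_le: "(\<Sum>\<^sub>\<infinity>j. ?h l j) \<le> B * \<bar>a l\<bar>" for l
    unfolding inner using mult_right_mono[OF b(2)[of l], of "\<bar>a l\<bar>"] by (simp add: mult.commute)
  have outer: "(\<lambda>l. \<Sum>\<^sub>\<infinity>j. ?h l j) summable_on UNIV"
  proof (rule summable_on_comparison_test)
    show "(\<lambda>l. B * \<bar>a l\<bar>) summable_on UNIV"
      using a by (intro summable_on_cmult_right) auto
    show "(\<Sum>\<^sub>\<infinity>j. ?h l j) \<le> B * \<bar>a l\<bar>" for l
      by (rule inner_le)
    show "0 \<le> (\<Sum>\<^sub>\<infinity>j. ?h l j)" for l
      by (rule infsum_nonneg) simp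
  qed
  have row: "?h l summable_on UNIV" for l
    using b(1)[of l] summable_on_cmult_right[of "\<lambda>j. \<bar>b l j\<bar>" UNIV "\<bar>a l\<bar>"] by (simp add: abs_mult)
  \<comment> \<open>Absolute summability over pairs, obtained by summing along rows, is the core: it
    yields the columns and permits the exchange of sums that stands in for associativity of infinite
    matrix products.\<close>
  have P: "(\<lambda>(l, j). ?h l j) summable_on (UNIV \<times> UNIV)"
    by (rule summable_on_SigmaI[where g = "\<lambda>l. \<Sum>\<^sub>\<infinity>j. ?h l j"])
       (use row outer in \<open>auto intro: has_sum_infsum\<close>)
  then show prod: "(\<lambda>(l, j). \<bar>a l * b l j\<bar>) summable_on UNIV"
    by (simp add: case_prod_unfold)
  have P': "(\<lambda>(j, l). ?h l j) summable_on (UNIV \<times> UNIV)"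
    using summable_on_swap[of "\<lambda>(l, j). ?h l j" UNIV UNIV] P by simp
  have col: "(\<lambda>l. ?h l j) summable_on UNIV" for j
    using summable_on_SigmaD1[of "\<lambda>j l. ?h l j" UNIV "\<lambda>_. UNIV" j] P' by simp
  then show col': "(\<lambda>l. \<bar>a l * b l j\<bar>) summable_on UNIV" for j
    by simp
  have cols: "(\<lambda>j. \<Sum>\<^sub>\<infinity>l. ?h l j) summable_on UNIV"
    using summable_on_Sigma_banach[of "\<lambda>j l. ?h l j" UNIV "\<lambda>_. UNIV"] P' by simp
  have le: "\<bar>\<Sum>\<^sub>\<infinity>l. a l * b l j\<bar> \<le> (\<Sum>\<^sub>\<infinity>l. ?h l j)" for j
    using norm_infsum_bound[of "\<lambda>l. a l * b l j" UNIV] col'[of j] by simp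
  show im: "(\<lambda>j. \<bar>\<Sum>\<^sub>\<infinity>l. a l * b l j\<bar>) summable_on UNIV"
    by (rule summable_on_comparison_test[OF cols]) (use le in auto)
  have "(\<Sum>\<^sub>\<infinity>j. \<bar>\<Sum>\<^sub>\<infinity>l. a l * b l j\<bar>) \<le> (\<Sum>\<^sub>\<infinity>j. \<Sum>\<^sub>\<infinity>l. ?h l j)"
    using im cols le by (intro infsum_mono) auto
  also have "\<dots> = (\<Sum>\<^sub>\<infinity>l. \<Sum>\<^sub>\<infinity>j. ?h l j)"
    by (rule infsum_swap_banach) (use P' in simp)
  also have "\<dots> \<le> (\<Sum>\<^sub>\<infinity>l. B * \<bar>a l\<bar>)"
    using outer a inner_le by (intro infsum_mono summable_on_cmult_right) auto
  also have "\<dots> = B * (\<Sum>\<^sub>\<infinity>l. \<bar>a l\<bar>)"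
    using a by (intro infsum_cmult_right) auto
  finally show "(\<Sum>\<^sub>\<infinity>j. \<bar>\<Sum>\<^sub>\<infinity>l. a l * b l j\<bar>) \<le> B * (\<Sum>\<^sub>\<infinity>l. \<bar>a l\<bar>)" .
qed

lemma has_sum_singleton: "((\<lambda>j. if j = i then c else 0) has_sum (c :: real)) UNIV"
  by (rule has_sum_finite_neutralI[of "{i}"]) auto

lemma abs_le_infsum_abs:
  fixes f :: "'a \<Rightarrow> real"
  assumes "(\<lambda>x. \<bar>f x\<bar>) summable_on UNIV"
  shows "\<bar>f x\<bar> \<le> (\<Sum>\<^sub>\<infinity>y. \<bar>f y\<bar>)"
  using finite_sum_le_infsum[of "\<lambda>y. \<bar>f y\<bar>" UNIV "{x}"] assms by simp

text \<open>Follows from (k + n)! \<ge> k!. The bound is crude, but only the order x^n of the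
  remainder matters later.\<close>

lemma exp_tail_sums:
  fixes x :: real
  assumes "0 \<le> x"
  shows "summable (\<lambda>k. x ^ (k + n) / fact (k + n))"
    and "(\<Sum>k. x ^ (k + n) / fact (k + n)) \<le> x ^ n * exp x"
proof -
  have s: "(\<lambda>k. x ^ k / fact k) sums exp x"
    using exp_converges[of x] by (simp add: field_simps)
  have s1: "(\<lambda>k. x ^ n * (x ^ k / fact k)) sums (x ^ n * exp x)"
    by (rule sums_mult[OF s])
  show sm: "summable (\<lambda>k. x ^ (k + n) / fact (k + n))"
    using sums_summable[OF s] summable_iff_shift[of "\<lambda>k. x ^ k / fact k" n] by simp
  have "x ^ (k + n) / fact (k + n) \<le> x ^ n * (x ^ k / fact k)" for k
    using assms fact_mono[of k "k + n", where ?'a = real]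
    by (simp add: power_add mult.commute frac_le)
  from suminf_le[OF this sm sums_summable[OF s1]] show
    "(\<Sum>k. x ^ (k + n) / fact (k + n)) \<le> x ^ n * exp x"
    using sums_unique[OF s1] by simp
qed

locale bounded_generator =
  fixes Q :: "'i::countable \<Rightarrow> 'i \<Rightarrow> real" and C :: real
  assumes gen: "is_generator Q" and diag_le: "\<And>i. \<bar>Q i i\<bar> \<le> C"
begin

lemma C_nonneg: "0 \<le> C"
  using diag_le abs_ge_zero order_trans by blast

lemma off_diag_nonneg: "i \<noteq> j \<Longrightarrow> 0 \<le> Q i j"
  using gen by (auto simp: is_generator_def)

text \<open>The absolute value changes only the diagonal entry, so the zero row sum is corrected at
  one point. The result is at most \<open>2 * C\<close>, the origin of every factor
  \<open>2 * C\<close> below.\<close>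

lemma has_sum_abs_row: "((\<lambda>j. \<bar>Q i j\<bar>) has_sum (\<bar>Q i i\<bar> - Q i i)) UNIV"
proof -
  have "((\<lambda>j. Q i j + (if j = i then \<bar>Q i i\<bar> - Q i i else 0)) has_sum 0 + (\<bar>Q i i\<bar> - Q i i)) UNIV"
    using gen by (intro has_sum_add has_sum_singleton) (auto simp: is_generator_def)
  moreover have "Q i j + (if j = i then \<bar>Q i i\<bar> - Q i i else 0) = \<bar>Q i j\<bar>" for j
    using off_diag_nonneg[of i j] by auto
  ultimately show ?thesis by simp
qed

lemma row_abs_summable: "(\<lambda>j. \<bar>Q i j\<bar>) summable_on UNIV"
  using has_sum_abs_row[of i] by (auto simp: summable_on_def)

lemma infsum_row_le: "(\<Sum>\<^sub>\<infinity>j. \<bar>Q i j\<bar>) \<le> 2 * C"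
  using infsumI[OF has_sum_abs_row[of i]] diag_le[of i] by simp

lemma qpow_row: "(\<lambda>j. \<bar>qpow Q k i j\<bar>) summable_on UNIV \<and> (\<Sum>\<^sub>\<infinity>j. \<bar>qpow Q k i j\<bar>) \<le> (2 * C) ^ k"
proof (induction k)
  case 0
  have "((\<lambda>j. \<bar>qpow Q 0 i j\<bar>) has_sum 1) UNIV"
    using has_sum_singleton[of i 1] by (rule has_sum_cong[THEN iffD1, rotated]) auto
  then show ?case
    using infsumI by (fastforce simp: summable_on_def)
next
  case (Suc k)
  note a = conjunct1[OF Suc.IH]
  show ?case
  proof
    show "(\<lambda>j. \<bar>qpow Q (Suc k) i j\<bar>) summable_on UNIV"
      using abs_summable_kernel_image[OF a row_abs_summable infsum_row_le] by simp
    have "(\<Sum>\<^sub>\<infinity>j. \<bar>qpow Q (Suc k) i j\<bar>) \<le> 2 * C * (\<Sum>\<^sub>\<infinity>l. \<bar>qpow Q k i l\<bar>)"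
      using infsum_kernel_image_le[OF a row_abs_summable infsum_row_le] by simp
    also have "\<dots> \<le> 2 * C * (2 * C) ^ k"
      using Suc.IH C_nonneg by (intro mult_left_mono) auto
    finally show "(\<Sum>\<^sub>\<infinity>j. \<bar>qpow Q (Suc k) i j\<bar>) \<le> (2 * C) ^ Suc k" by simp
  qed
qed

lemma abs_qpow_le: "\<bar>qpow Q k i j\<bar> \<le> (2 * C) ^ k"
  using abs_le_infsum_abs[of "qpow Q k i" j] qpow_row[of k i] by linarith

text \<open>Entries of the k-th power are at most (2C)^k, so the tail is dominated termwise by that
  of the scalar series for exp(2Ct). The bound is uniform in \<open>i\<close> and \<open>j\<close>.
  With \<open>n = 1\<close> and \<open>i = j\<close> it says that the chain is likely to be found
  where it was.\<close>

lemma trans_fun_expansion: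
  assumes "0 \<le> t"
  shows "\<bar>trans_fun Q t i j - (\<Sum>k<n. t ^ k / fact k * qpow Q k i j)\<bar> \<le> (2 * C * t) ^ n * exp (2 * C * t)"
proof -
  let ?f = "\<lambda>k. t ^ k / fact k * qpow Q k i j"
  have x: "0 \<le> 2 * C * t" using C_nonneg assms by simp
  have le: "norm (?f k) \<le> (2 * C * t) ^ k / fact k" for k
    using mult_left_mono[OF abs_qpow_le[of k i j], of "t ^ k / fact k"] assms
    by (simp add: abs_mult power_mult_distrib mult.commute)
  have "summable (\<lambda>k. (2 * C * t) ^ k / fact k)"
    using exp_tail_sums(1)[OF x, of 0] by simp
  then have sf: "summable ?f"
    by (rule summable_comparison_test'[where N = 0]) (use le in simp)
  have tail: "trans_fun Q t i j - sum ?f {..<n} = (\<Sum>k. ?f (k + n))"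
    unfolding trans_fun_def using suminf_split_initial_segment[OF sf, of n] by simp
  have sn: "summable (\<lambda>k. norm (?f (k + n)))"
    by (rule summable_comparison_test'[OF exp_tail_sums(1)[OF x, of n], where N = 0])
       (use le in simp)
  have "\<bar>\<Sum>k. ?f (k + n)\<bar> \<le> (\<Sum>k. norm (?f (k + n)))"
    using summable_norm[OF sn] by simp
  also have "\<dots> \<le> (\<Sum>k. (2 * C * t) ^ (k + n) / fact (k + n))"
    by (rule suminf_le[OF le sn exp_tail_sums(1)[OF x]])
  also have "\<dots> \<le> (2 * C * t) ^ n * exp (2 * C * t)"
    by (rule exp_tail_sums(2)[OF x])
  finally show ?thesis unfolding tail .
qed

end

section \<open>Shortest paths\<close>

text \<open>Paths grow at their end because \<open>qpow\<close> multiplies by \<open>Q\<close> on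
  the right.\<close>

lemma is_path_snoc:
  assumes "is_path Q p" "0 < Q (last p) j"
  shows "is_path Q (p @ [j])"
proof -
  have "0 < Q ((p @ [j]) ! l) ((p @ [j]) ! Suc l)" if "Suc l < length (p @ [j])" for l
  proof (cases "Suc l < length p")
    case True
    then show ?thesis using assms by (auto simp: is_path_def nth_append)
  next
    case False
    then have "l = length p - 1" "p \<noteq> []" using that assms by (auto simp: is_path_def)
    then show ?thesis using assms(2) that by (auto simp: nth_append last_conv_nth)
  qed
  then show ?thesis by (simp add: is_path_def)
qed

lemma is_path_snocD:
  assumes "is_path Q (p @ [j])" "p \<noteq> []"
  shows "is_path Q p" "0 < Q (last p) j"
proof -
  have *: "0 < Q ((p @ [j]) ! l) ((p @ [j]) ! Suc l)" if "l < length p" for l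
    using assms(1) that by (simp add: is_path_def)
  show "is_path Q p"
    unfolding is_path_def
  proof (intro conjI allI impI assms(2))
    fix l assume "Suc l < length p"
    then show "0 < Q (p ! l) (p ! Suc l)" using *[of l] by (simp add: nth_append)
  qed
  show "0 < Q (last p) j"
    using *[of "length p - 1"] assms(2) by (simp add: nth_append last_conv_nth)
qed

lemma path_weight_snoc:
  assumes "p \<noteq> []"
  shows "path_weight Q (p @ [j]) = path_weight Q p * Q (last p) j"
proof -
  obtain n where n: "length p = Suc n" using assms by (cases p) auto
  have "path_weight Q (p @ [j]) = (\<Prod>l<n. Q ((p @ [j]) ! l) ((p @ [j]) ! Suc l)) * Q ((p @ [j]) ! n) ((p @ [j]) ! Suc n)"
    by (simp add: path_weight_def n)
  also have "(\<Prod>l<n. Q ((p @ [j]) ! l) ((p @ [j]) ! Suc l)) = path_weight Q p"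
    unfolding path_weight_def by (intro prod.cong) (auto simp: n nth_append)
  finally show ?thesis using assms by (simp add: n nth_append last_conv_nth)
qed

lemma path_weight_pos: "is_path Q p \<Longrightarrow> 0 < path_weight Q p"
  unfolding path_weight_def is_path_def by (intro prod_pos) auto

lemma dmin_le_path: "is_path Q p \<Longrightarrow> hd p \<in> S \<Longrightarrow> last p \<in> J \<Longrightarrow> dmin Q S J \<le> enat (length p - 1)"
  unfolding dmin_def by (intro Inf_lower) auto

text \<open>The infimum of the empty set in \<open>enat\<close> is \<infinity>, so a finite value
  means that paths exist, and well-ordering provides a shortest one.\<close>

lemma dmin_attained:
  assumes "dmin Q S J = enat k"
  obtains p where "is_path Q p" "hd p \<in> S" "last p \<in> J" "length p = Suc k"
proof -
  let ?A = "{enat (length p - 1) | p. is_path Q p \<and> hd p \<in> S \<and> last p \<in> J}"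
  have "?A \<noteq> {}" using assms by (auto simp: dmin_def Inf_enat_def split: if_splits)
  then have "Inf ?A \<in> ?A"
    unfolding Inf_enat_def by (auto intro: LeastI)
  then obtain p where "is_path Q p" "hd p \<in> S" "last p \<in> J" "length p - 1 = k"
    using assms unfolding dmin_def by auto
  moreover from this have "length p = Suc k" by (cases p) (auto simp: is_path_def)
  ultimately show ?thesis using that by blast
qed

lemma dmin_eq_INF: "dmin Q S J = (INF j\<in>J. dmin Q S {j})"
proof (rule antisym)
  show "dmin Q S J \<le> (INF j\<in>J. dmin Q S {j})"
    unfolding dmin_def by (intro INF_greatest Inf_superset_mono) auto
  show "(INF j\<in>J. dmin Q S {j}) \<le> dmin Q S J"
    unfolding dmin_def[of Q S J]
  proof (rule Inf_greatest, clarify)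
    fix p assume "is_path Q p" "hd p \<in> S" "last p \<in> J"
    then show "(INF j\<in>J. dmin Q S {j}) \<le> enat (length p - 1)"
      by (intro INF_lower2[of "last p"] dmin_le_path) auto
  qed
qed

lemma dmin_step:
  assumes "0 < Q l j"
  shows "dmin Q S {j} \<le> eSuc (dmin Q S {l})"
proof (cases "dmin Q S {l}")
  case (enat k)
  then obtain p where p: "is_path Q p" "hd p \<in> S" "last p \<in> {l}" "length p = Suc k"
    by (rule dmin_attained)
  have "dmin Q S {j} \<le> enat (length (p @ [j]) - 1)"
    using p assms by (intro dmin_le_path is_path_snoc) (auto simp: is_path_def)
  then show ?thesis using p enat by (simp add: eSuc_enat)
qed simp

lemma dmin_eq_0_iff: "dmin Q S {j} = 0 \<longleftrightarrow> j \<in> S"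
proof
  assume "dmin Q S {j} = 0"
  then obtain p where "is_path Q p" "hd p \<in> S" "last p \<in> {j}" "length p = Suc 0"
    using dmin_attained[of Q S "{j}" 0] by (auto simp: zero_enat_def)
  then show "j \<in> S" by (cases p) auto
next
  assume "j \<in> S"
  then show "dmin Q S {j} = 0"
    using dmin_le_path[of Q "[j]" S "{j}"] by (simp add: is_path_def zero_enat_def[symmetric])
qed

text \<open>A nonzero sum has a nonzero term, so cancellation is harmless in this direction. A
  diagonal factor adds no jump, hence a length of at most \<open>k\<close> instead of exactly
  \<open>k\<close>.\<close>

lemma (in bounded_generator) qpow_nonzero_imp_path:
  "qpow Q k i j \<noteq> 0 \<Longrightarrow> \<exists>p. is_path Q p \<and> hd p = i \<and> last p = j \<and> length p - 1 \<le> k"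
proof (induction k arbitrary: j)
  case 0
  then show ?case by (intro exI[of _ "[i]"]) (auto simp: is_path_def split: if_splits)
next
  case (Suc k)
  have "\<exists>l. qpow Q k i l * Q l j \<noteq> 0"
    using Suc.prems infsum_0[of UNIV "\<lambda>l. qpow Q k i l * Q l j"] by auto
  then obtain l where l: "qpow Q k i l \<noteq> 0" "Q l j \<noteq> 0" by auto
  from Suc.IH[OF l(1)] obtain p where
    p: "is_path Q p" "hd p = i" "last p = l" "length p - 1 \<le> k" by auto
  show ?case
  proof (cases "l = j")
    case True
    then show ?thesis using p by (intro exI[of _ p]) auto
  next
    case False
    then have "0 < Q l j" using off_diag_nonneg[of l j] l by auto
    then show ?thesis using p is_path_snoc[of Q p j]
      by (intro exI[of _ "p @ [j]"]) (auto simp: is_path_def)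
  qed
qed

section \<open>Taylor coefficients of the law as sums over shortest paths\<close>

locale bounded_generator_init = bounded_generator Q C for Q :: "'i::countable \<Rightarrow> 'i \<Rightarrow> real" and C +
  fixes \<rho> :: "'i \<Rightarrow> real"
  assumes \<rho>_nonneg: "\<And>i. 0 \<le> \<rho> i" and \<rho>_sum: "(\<rho> has_sum 1) UNIV"
begin

abbreviation depth :: "'i \<Rightarrow> enat" where "depth j \<equiv> dmin Q (supp \<rho>) {j}"

text \<open>Entry \<open>j\<close> of the row vector \<rho> Q^k, which is the k-th derivative at
  time 0 of the probability of being in \<open>j\<close>.\<close>

definition deriv_mass :: "nat \<Rightarrow> 'i \<Rightarrow> real" where
  "deriv_mass k j = (\<Sum>\<^sub>\<infinity>i. \<rho> i * qpow Q k i j)"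

lemma \<rho>_abs_summable: "(\<lambda>i. \<bar>\<rho> i\<bar>) summable_on UNIV"
  using \<rho>_sum \<rho>_nonneg by (auto simp: summable_on_def)

text \<open>A nonzero term would give a path from the support that is shorter than the depth. The
  termwise form serves \<open>prob_at_unreachable\<close>, where the sum over \<open>k\<close> is
  nested inside the sum over \<open>i\<close>.\<close>

lemma init_qpow_eq_0:
  assumes "enat k < depth j"
  shows "\<rho> i * qpow Q k i j = 0"
proof (rule ccontr)
  assume *: "\<rho> i * qpow Q k i j \<noteq> 0"
  then obtain p where p: "is_path Q p" "hd p = i" "last p = j" "length p - 1 \<le> k"
    using qpow_nonzero_imp_path by force
  have "i \<in> supp \<rho>" using * \<rho>_nonneg[of i] by (auto simp: supp_def less_le)
  then have "depth j \<le> enat (length p - 1)" using p by (intro dmin_le_path) auto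
  also have "\<dots> \<le> enat k" using p by simp
  finally show False using assms by simp
qed

lemma deriv_mass_eq_0: "enat k < depth j \<Longrightarrow> deriv_mass k j = 0"
  unfolding deriv_mass_def by (intro infsum_0) (auto dest: init_qpow_eq_0)

lemma init_qpow_abs_summable: "(\<lambda>i. \<bar>\<rho> i * qpow Q k i j\<bar>) summable_on UNIV"
  using abs_summable_kernel_column[OF \<rho>_abs_summable, of "qpow Q k"] qpow_row by blast

lemma has_sum_deriv_mass: "((\<lambda>i. \<rho> i * qpow Q k i j) has_sum deriv_mass k j) UNIV"
  unfolding deriv_mass_def
  using abs_summable_summable[of "\<lambda>i. \<rho> i * qpow Q k i j" UNIV] init_qpow_abs_summable[of k j]
  by (intro has_sum_infsum) simp

text \<open>This is (\<rho> Q^k) Q = \<rho> (Q^k Q), an exchange of the sums over \<open>i\<close>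
  and \<open>l\<close>. With \<open>j\<close> fixed, the middle factors form the kernel
  \<open>b\<close>, whose rows are uniformly absolutely summable.\<close>

lemma has_sum_deriv_mass_Suc: "((\<lambda>l. deriv_mass k l * Q l j) has_sum deriv_mass (Suc k) j) UNIV"
proof -
  define b where "b = (\<lambda>i l. qpow Q k i l * Q l j)"
  have Qlj: "\<bar>Q l j\<bar> \<le> 2 * C" for l
    using abs_le_infsum_abs[OF row_abs_summable, of l j] infsum_row_le[of l] by linarith
  have le: "\<bar>b i l\<bar> \<le> 2 * C * \<bar>qpow Q k i l\<bar>" for i l
    unfolding b_def abs_mult using mult_right_mono[OF Qlj[of l], of "\<bar>qpow Q k i l\<bar>"] by (simp add: mult.commute)
  have q: "(\<lambda>l. 2 * C * \<bar>qpow Q k i l\<bar>) summable_on UNIV" for i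
    using qpow_row[of k i] by (intro summable_on_cmult_right) auto
  have b1: "(\<lambda>l. \<bar>b i l\<bar>) summable_on UNIV" for i
    by (rule summable_on_comparison_test[OF q le]) auto
  have b2: "(\<Sum>\<^sub>\<infinity>l. \<bar>b i l\<bar>) \<le> 2 * C * (2 * C) ^ k" for i
  proof -
    have "(\<Sum>\<^sub>\<infinity>l. \<bar>b i l\<bar>) \<le> (\<Sum>\<^sub>\<infinity>l. 2 * C * \<bar>qpow Q k i l\<bar>)"
      by (intro infsum_mono b1 q le)
    also have "\<dots> = 2 * C * (\<Sum>\<^sub>\<infinity>l. \<bar>qpow Q k i l\<bar>)"
      by (rule infsum_cmult_right')
    also have "\<dots> \<le> 2 * C * (2 * C) ^ k"
      using qpow_row[of k i] C_nonneg by (intro mult_left_mono) auto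
    finally show ?thesis .
  qed
  have col: "(\<Sum>\<^sub>\<infinity>i. \<rho> i * b i l) = deriv_mass k l * Q l j" for l
    unfolding b_def deriv_mass_def mult.assoc[symmetric] by (rule infsum_cmult_left')
  have row: "(\<Sum>\<^sub>\<infinity>l. \<rho> i * b i l) = \<rho> i * qpow Q (Suc k) i j" for i
    unfolding b_def qpow.simps by (rule infsum_cmult_right')
  have "(\<lambda>x. norm (case x of (i, l) \<Rightarrow> \<rho> i * b i l)) summable_on UNIV \<times> UNIV"
    using abs_summable_kernel_prod[of \<rho> b, OF \<rho>_abs_summable b1 b2] by (simp add: case_prod_unfold)
  then have "(\<lambda>(i, l). \<rho> i * b i l) summable_on UNIV \<times> UNIV"
    by (rule abs_summable_summable)
  from infsum_swap_banach[OF this]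
  have "(\<Sum>\<^sub>\<infinity>l. deriv_mass k l * Q l j) = deriv_mass (Suc k) j"
    unfolding row col by (simp add: deriv_mass_def)
  moreover have "(\<lambda>l. norm (deriv_mass k l * Q l j)) summable_on UNIV"
    using abs_summable_kernel_image[of \<rho> b, OF \<rho>_abs_summable b1 b2] unfolding col by simp
  then have "(\<lambda>l. deriv_mass k l * Q l j) summable_on UNIV"
    by (rule abs_summable_summable)
  ultimately show ?thesis by (metis has_sum_infsum)
qed

text \<open>A nonzero term of the matrix product \<open>\<rho> Q^k\<close> at \<open>j\<close> that used a diagonal entry would give
  a shorter path to \<open>j\<close>, so for \<open>k = depth j\<close> only the shortest paths contribute.\<close>

lemma has_sum_min_paths:
  "depth j = enat k \<Longrightarrow> ((\<lambda>p. \<rho> (hd p) * path_weight Q p) has_sum deriv_mass k j) (min_paths Q (supp \<rho>) {j})"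
proof (induction k arbitrary: j)
  case 0
  then have j: "j \<in> supp \<rho>" using dmin_eq_0_iff[of Q "supp \<rho>" j] by (simp add: zero_enat_def)
  have "min_paths Q (supp \<rho>) {j} = {[j]}"
  proof (intro equalityI subsetI)
    fix p assume "p \<in> min_paths Q (supp \<rho>) {j}"
    then have "length p - 1 = 0" "p \<noteq> []" "last p = j"
      using 0 by (auto simp: min_paths_def is_path_def)
    then show "p \<in> {[j]}" by (cases p) auto
  qed (use 0 j in \<open>auto simp: min_paths_def is_path_def\<close>)
  moreover have "deriv_mass 0 j = \<rho> j"
  proof -
    have "(\<lambda>i. \<rho> i * qpow Q 0 i j) = (\<lambda>i. if i = j then \<rho> j else 0)" by auto
    then show ?thesis
      using infsumI[OF has_sum_singleton[of j "\<rho> j"]] by (simp only: deriv_mass_def)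
  qed
  ultimately show ?case
    using has_sum_finite[of "{[j]}" "\<lambda>p. \<rho> (hd p) * path_weight Q p"] by (simp add: path_weight_def)
next
  case (Suc k)
  define A where "A = {l. depth l = enat k \<and> 0 < Q l j}"
  define mp where "mp = (\<lambda>l. min_paths Q (supp \<rho>) {l})"
  let ?f = "\<lambda>(l, p). \<rho> (hd p) * path_weight Q p * Q l j"
  have outer: "((\<lambda>l. deriv_mass k l * Q l j) has_sum deriv_mass (Suc k) j) A"
  proof (rule has_sum_cong_neutral[THEN iffD1, OF _ _ _ has_sum_deriv_mass_Suc])
    fix l assume l: "l \<in> UNIV - A"
    show "deriv_mass k l * Q l j = 0"
    proof (cases "l = j")
      case True
      then show ?thesis using deriv_mass_eq_0[of k j] Suc.prems by simp
    next
      case False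
      show ?thesis
      proof (cases "0 < Q l j")
        case True
        \<comment> \<open>A predecessor of \<open>j\<close> has depth at least \<open>k\<close>.
          Outside \<open>A\<close> the depth is strictly larger, so its mass of order
          \<open>k\<close> vanishes.\<close>
        then have "eSuc (enat k) \<le> eSuc (depth l)"
          using dmin_step[of Q l j "supp \<rho>"] Suc.prems by (simp add: eSuc_enat)
        then have "enat k < depth l" using l True by (auto simp: A_def less_le)
        then show ?thesis by (simp add: deriv_mass_eq_0)
      next
        case F: False
        with off_diag_nonneg[OF False] show ?thesis by simp
      qed
    qed
  qed auto
  have inner: "((\<lambda>p. ?f (l, p)) has_sum deriv_mass k l * Q l j) (mp l)" if "l \<in> A" for l
    using has_sum_cmult_left[OF Suc.IH[of l], of "Q l j"] that by (simp add: A_def mp_def)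
  have nonneg: "0 \<le> ?f (l, p)" if "l \<in> A" "p \<in> mp l" for l p
    using that \<rho>_nonneg path_weight_pos[of Q p] by (auto simp: A_def mp_def min_paths_def)
  have S: "(?f has_sum deriv_mass (Suc k) j) (Sigma A mp)"
    using inner outer nonneg
    by (intro has_sum_SigmaI[where g = "\<lambda>l. deriv_mass k l * Q l j"]
        summable_on_SigmaI[where g = "\<lambda>l. deriv_mass k l * Q l j"])
       (auto simp: summable_on_def)
  \<comment> \<open>Shortest paths to \<open>j\<close> are the shortest paths to members of
    \<open>A\<close> with \<open>j\<close> appended. The last state of the shortened path recovers
    \<open>l\<close>, so \<open>h\<close> is injective.\<close>
  define h :: "'i \<times> 'i list \<Rightarrow> 'i list" where "h = (\<lambda>(l, p). p @ [j])"
  have mpD: "p \<noteq> []" "is_path Q p" "last p = l" "hd p \<in> supp \<rho>" "length p = Suc k" if "l \<in> A" "p \<in> mp l" for l p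
  proof -
    show "p \<noteq> []" "is_path Q p" "last p = l" "hd p \<in> supp \<rho>"
      using that by (auto simp: mp_def min_paths_def is_path_def)
    have "length p - 1 = k" using that by (simp add: mp_def min_paths_def A_def)
    with \<open>p \<noteq> []\<close> show "length p = Suc k" by (cases p) auto
  qed
  have inj: "inj_on h (Sigma A mp)"
    using mpD(3) by (auto simp: inj_on_def h_def)
  have im: "h ` Sigma A mp = min_paths Q (supp \<rho>) {j}"
  proof (intro equalityI subsetI)
    fix q assume "q \<in> h ` Sigma A mp"
    then obtain l p where lp: "l \<in> A" "p \<in> mp l" "q = p @ [j]" by (auto simp: h_def)
    then show "q \<in> min_paths Q (supp \<rho>) {j}"
      using mpD[OF lp(1,2)] Suc.prems is_path_snoc[of Q p j] by (auto simp: min_paths_def A_def)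
  next
    fix q assume q: "q \<in> min_paths Q (supp \<rho>) {j}"
    then have q': "is_path Q q" "hd q \<in> supp \<rho>" "last q = j" "length q - 1 = Suc k"
      using Suc.prems by (auto simp: min_paths_def)
    define p where "p = butlast q"
    have "q \<noteq> []" using q'(4) by auto
    then have qp: "q = p @ [j]" using q'(3) append_butlast_last_id[of q] by (simp add: p_def)
    have p: "p \<noteq> []" "length p = Suc k" using q'(4) qp by auto
    have path: "is_path Q p" "0 < Q (last p) j" using is_path_snocD[of Q p j] q'(1) qp p by auto
    have hd: "hd p \<in> supp \<rho>" using q'(2) qp p by simp
    have "depth (last p) \<le> enat k" using dmin_le_path[OF path(1) hd, of "{last p}"] p by simp
    moreover have "eSuc (enat k) \<le> eSuc (depth (last p))"
      using dmin_step[of Q "last p" j "supp \<rho>", OF path(2)] Suc.prems by (simp add: eSuc_enat)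
    ultimately have "depth (last p) = enat k" by simp
    then have "last p \<in> A" "p \<in> mp (last p)" using path p hd by (auto simp: A_def mp_def min_paths_def)
    then show "q \<in> h ` Sigma A mp" unfolding qp h_def by force
  qed
  have "((\<lambda>p. \<rho> (hd p) * path_weight Q p) \<circ> h has_sum deriv_mass (Suc k) j) (Sigma A mp)"
    using S by (rule has_sum_cong[THEN iffD1, rotated])
      (auto simp: h_def path_weight_snoc mpD hd_append)
  then show ?case unfolding im[symmetric] has_sum_reindex[OF inj] .
qed

text \<open>The path sum has nonnegative terms, and one shortest path from the support already
  contributes a positive one. Thus the negative diagonal of \<open>Q\<close> cannot cancel the
  leading coefficient.\<close>

lemma deriv_mass_pos:
  assumes "depth j = enat k"
  shows "0 < deriv_mass k j"
proof -
  obtain p where p: "is_path Q p" "hd p \<in> supp \<rho>" "last p \<in> {j}" "length p = Suc k"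
    using dmin_attained[OF assms] by blast
  have mem: "p \<in> min_paths Q (supp \<rho>) {j}" using p assms by (simp add: min_paths_def)
  have nonneg: "0 \<le> \<rho> (hd q) * path_weight Q q" if "q \<in> min_paths Q (supp \<rho>) {j}" for q
    using that \<rho>_nonneg path_weight_pos[of Q q] by (auto simp: min_paths_def)
  have "sum (\<lambda>q. \<rho> (hd q) * path_weight Q q) {p} \<le> deriv_mass k j"
    using mem nonneg
    by (intro has_sum_mono2[OF has_sum_finite has_sum_min_paths[OF assms]]) auto
  moreover have "0 < \<rho> (hd p) * path_weight Q p"
    using p path_weight_pos[of Q p] by (simp add: supp_def)
  ultimately show ?thesis by simp
qed

lemma deriv_mass_nonneg: "enat k \<le> depth j \<Longrightarrow> 0 \<le> deriv_mass k j"
  using deriv_mass_eq_0[of k j] deriv_mass_pos[of j k] by (cases "depth j = enat k") (auto simp: less_le)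

text \<open>When all targets lie at the same depth, the shortest paths to \<open>J\<close> are those
  to its single states, and they split disjointly by endpoint.\<close>

lemma Lambda_eq_sum_deriv_mass:
  assumes "finite J" "J \<noteq> {}" and far: "\<And>j. j \<in> J \<Longrightarrow> depth j = enat d"
  shows "Lambda Q \<rho> J = (\<Sum>j\<in>J. deriv_mass d j)"
proof -
  have "dmin Q (supp \<rho>) J = enat d"
    unfolding dmin_eq_INF[of Q _ J] using assms by (simp add: far)
  then have "min_paths Q (supp \<rho>) J = (\<Union>j\<in>J. min_paths Q (supp \<rho>) {j})"
    using far by (auto simp: min_paths_def)
  moreover have "((\<lambda>p. \<rho> (hd p) * path_weight Q p) has_sum (\<Sum>j\<in>J. deriv_mass d j))
      (\<Union>j\<in>J. min_paths Q (supp \<rho>) {j})"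
    using assms(1) far
  proof (induction J)
    case (insert j J)
    have "min_paths Q (supp \<rho>) {j} \<inter> (\<Union>j\<in>J. min_paths Q (supp \<rho>) {j}) = {}"
      using insert.hyps by (auto simp: min_paths_def)
    then show ?case
      using insert has_sum_Un_disjoint[OF has_sum_min_paths[of j d]] by simp
  qed simp
  ultimately show ?thesis unfolding Lambda_def by (simp add: infsumI)
qed

end

section \<open>Hitting probabilities of a single chain\<close>

text \<open>Countable additivity is carried from sequences to a countable index type along
  \<open>to_nat\<close>; numbers that code nothing get the empty set. It is applied to states and to
  lists of states.\<close>

lemma (in finite_measure) has_sum_measure_UN:
  fixes A :: "'b::countable \<Rightarrow> 'a set"
  assumes A: "range A \<subseteq> sets M" "disjoint_family A"
  shows "((\<lambda>i. measure M (A i)) has_sum measure M (\<Union>i. A i)) UNIV"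
proof -
  define A' where "A' = (\<lambda>n. if n \<in> range (to_nat :: 'b \<Rightarrow> nat) then A (from_nat n) else {})"
  have "(\<Union>n. A' n) = (\<Union>i. A i)"
    by (force simp: A'_def split: if_splits)
  moreover have "(\<lambda>n. measure M (A' n)) sums measure M (\<Union>n. A' n)"
  proof (rule finite_measure_UNION)
    show "range A' \<subseteq> sets M" using A by (auto simp: A'_def)
    show "disjoint_family A'"
      using A(2) by (fastforce simp: A'_def disjoint_family_on_def)
  qed
  ultimately have "((\<lambda>n. measure M (A' n)) has_sum measure M (\<Union>i. A i)) UNIV"
    by (intro sums_nonneg_imp_has_sum) auto
  then have "((\<lambda>n. measure M (A' n)) has_sum measure M (\<Union>i. A i)) (range (to_nat :: 'b \<Rightarrow> nat))"
    by (rule has_sum_cong_neutral[THEN iffD1, rotated 3]) (auto simp: A'_def)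
  then show ?thesis
    by (subst (asm) has_sum_reindex) (auto simp: o_def A'_def)
qed

lemma has_sum_sum_finite:
  fixes f :: "'b \<Rightarrow> 'c \<Rightarrow> real"
  assumes "finite K" "\<And>k. k \<in> K \<Longrightarrow> (f k has_sum s k) A"
  shows "((\<lambda>i. \<Sum>k\<in>K. f k i) has_sum (\<Sum>k\<in>K. s k)) A"
  using assms by (induction K) (auto intro: has_sum_add)

locale ctmc = bounded_generator_init Q C \<rho> + prob_space M
  for Q :: "'i::countable \<Rightarrow> 'i \<Rightarrow> real" and C \<rho> and M :: "'a measure" +
  fixes Y :: "real \<Rightarrow> 'a \<Rightarrow> 'i"
  assumes ctmc: "is_ctmc M Q \<rho> Y"
begin

lemma Y_measurable[measurable]: "Y t \<in> measurable M (count_space UNIV)"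
  using ctmc by (simp add: is_ctmc_def)

lemma Y_right_const:
  assumes "\<omega> \<in> space M" "0 \<le> t"
  obtains \<epsilon> where "0 < \<epsilon>" "\<And>s. t \<le> s \<Longrightarrow> s < t + \<epsilon> \<Longrightarrow> Y s \<omega> = Y t \<omega>"
  using ctmc assms unfolding is_ctmc_def by blast

lemma Y_fdd:
  assumes "tt 0 = 0" "\<And>l. l < k \<Longrightarrow> tt l \<le> tt (Suc l)"
  shows "prob {\<omega>\<in>space M. \<forall>l\<le>k. Y (tt l) \<omega> = ii l}
    = \<rho> (ii 0) * (\<Prod>l<k. trans_fun Q (tt (Suc l) - tt l) (ii l) (ii (Suc l)))"
  using ctmc assms unfolding is_ctmc_def by blast

section \<open>Events at finitely many observation times\<close>

definition cylinder :: "(nat \<Rightarrow> 'i set) \<Rightarrow> nat \<Rightarrow> 'i list set" where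
  "cylinder S n = {xs. length xs = Suc n \<and> (\<forall>r\<le>n. xs ! r \<in> S r)}"

definition cyl_weight :: "(nat \<Rightarrow> real) \<Rightarrow> 'i list \<Rightarrow> real" where
  "cyl_weight tt xs = \<rho> (xs ! 0) * (\<Prod>l<length xs - 1. trans_fun Q (tt (Suc l) - tt l) (xs ! l) (xs ! Suc l))"

text \<open>\<open>is_ctmc\<close> prescribes the probability of one fixed trajectory on a grid.
  Constraints such as avoiding \<open>J\<close> allow infinitely many trajectories, and these are
  countably many disjoint events indexed by lists.\<close>

lemma has_sum_cylinder:
  assumes tt: "tt 0 = 0" "\<And>l. l < n \<Longrightarrow> tt l \<le> tt (Suc l)"
  shows "(cyl_weight tt has_sum prob {\<omega>\<in>space M. \<forall>r\<le>n. Y (tt r) \<omega> \<in> S r}) (cylinder S n)"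
proof -
  define A where "A = (\<lambda>xs. if xs \<in> cylinder S n then {\<omega>\<in>space M. \<forall>r\<le>n. Y (tt r) \<omega> = xs ! r} else {})"
  have "((\<lambda>xs. prob (A xs)) has_sum prob (\<Union>xs. A xs)) UNIV"
  proof (rule has_sum_measure_UN)
    show "range A \<subseteq> sets M" by (auto simp: A_def)
    show "disjoint_family A"
    proof (unfold disjoint_family_on_def, intro ballI impI)
      fix xs ys :: "'i list" assume ne: "xs \<noteq> ys"
      show "A xs \<inter> A ys = {}"
      proof (rule ccontr)
        assume "A xs \<inter> A ys \<noteq> {}"
        then obtain \<omega> where "\<omega> \<in> A xs" "\<omega> \<in> A ys" by auto
        then have "xs = ys"
          by (auto simp: A_def cylinder_def list_eq_iff_nth_eq less_Suc_eq_le split: if_splits)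
        with ne show False by simp
      qed
    qed
  qed
  moreover have "(\<Union>xs. A xs) = {\<omega>\<in>space M. \<forall>r\<le>n. Y (tt r) \<omega> \<in> S r}"
  proof (intro equalityI subsetI)
    fix \<omega> assume \<omega>: "\<omega> \<in> {\<omega>\<in>space M. \<forall>r\<le>n. Y (tt r) \<omega> \<in> S r}"
    define xs where "xs = map (\<lambda>r. Y (tt r) \<omega>) [0..<Suc n]"
    have nth: "xs ! r = Y (tt r) \<omega>" if "r \<le> n" for r
      using that unfolding xs_def by (subst nth_map) (auto simp del: upt_Suc)
    have "length xs = Suc n" by (simp add: xs_def)
    then have "\<omega> \<in> A xs" using \<omega> nth by (auto simp: A_def cylinder_def)
    then show "\<omega> \<in> (\<Union>xs. A xs)" by blast
  qed (auto simp: A_def cylinder_def split: if_splits)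
  ultimately have "((\<lambda>xs. prob (A xs)) has_sum prob {\<omega>\<in>space M. \<forall>r\<le>n. Y (tt r) \<omega> \<in> S r}) UNIV"
    by simp
  then show ?thesis
  proof (rule has_sum_cong_neutral[THEN iffD1, rotated 3])
    fix xs assume "xs \<in> UNIV \<inter> cylinder S n"
    then show "prob (A xs) = cyl_weight tt xs"
      using Y_fdd[OF tt, where ii = "\<lambda>r. xs ! r"] by (simp add: A_def cyl_weight_def cylinder_def)
  qed (auto simp: A_def)
qed

text \<open>Because the state at time \<open>tt n\<close> is pinned to \<open>j\<close>, the factor
  of the last transition is the same for every list in the cylinder and leaves the sum. This is the
  Markov property at a deterministic time.\<close>

lemma markov_step:
  assumes tt: "tt 0 = 0" "\<And>l. l < n \<Longrightarrow> tt l \<le> tt (Suc l)" and T: "tt n \<le> T" and S: "S n = {j}"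
  shows "prob {\<omega>\<in>space M. (\<forall>r\<le>n. Y (tt r) \<omega> \<in> S r) \<and> Y T \<omega> = j'}
    = prob {\<omega>\<in>space M. \<forall>r\<le>n. Y (tt r) \<omega> \<in> S r} * trans_fun Q (T - tt n) j j'"
proof -
  define tt' where "tt' = tt(Suc n := T)"
  define S' where "S' = S(Suc n := {j'})"
  have "(cyl_weight tt' has_sum prob {\<omega>\<in>space M. \<forall>r\<le>Suc n. Y (tt' r) \<omega> \<in> S' r}) (cylinder S' (Suc n))"
    by (rule has_sum_cylinder) (use tt T in \<open>auto simp: tt'_def less_Suc_eq\<close>)
  also have "{\<omega>\<in>space M. \<forall>r\<le>Suc n. Y (tt' r) \<omega> \<in> S' r}
      = {\<omega>\<in>space M. (\<forall>r\<le>n. Y (tt r) \<omega> \<in> S r) \<and> Y T \<omega> = j'}"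
    by (auto simp: tt'_def S'_def le_Suc_eq)
  also have "cylinder S' (Suc n) = (\<lambda>xs. xs @ [j']) ` cylinder S n"
  proof (intro equalityI subsetI)
    fix ys assume ys: "ys \<in> cylinder S' (Suc n)"
    then have len: "length ys = Suc (Suc n)" and mem: "\<And>r. r \<le> Suc n \<Longrightarrow> ys ! r \<in> S' r"
      by (auto simp: cylinder_def)
    from mem[of "Suc n"] have "ys ! Suc n = j'" by (simp add: S'_def)
    moreover have "ys ! r \<in> S r" if "r \<le> n" for r
      using mem[of r] that by (simp add: S'_def)
    ultimately have "ys = take (Suc n) ys @ [j']" "take (Suc n) ys \<in> cylinder S n"
      using len take_Suc_conv_app_nth[of "Suc n" ys] by (auto simp: cylinder_def)
    then show "ys \<in> (\<lambda>xs. xs @ [j']) ` cylinder S n" by blast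
  qed (auto simp: cylinder_def S'_def nth_append le_Suc_eq)
  finally have h1: "((cyl_weight tt' \<circ> (\<lambda>xs. xs @ [j']))
      has_sum prob {\<omega>\<in>space M. (\<forall>r\<le>n. Y (tt r) \<omega> \<in> S r) \<and> Y T \<omega> = j'}) (cylinder S n)"
    by (subst (asm) has_sum_reindex) (auto simp: inj_on_def)
  have h2: "((\<lambda>xs. cyl_weight tt xs * trans_fun Q (T - tt n) j j') has_sum
      prob {\<omega>\<in>space M. \<forall>r\<le>n. Y (tt r) \<omega> \<in> S r} * trans_fun Q (T - tt n) j j') (cylinder S n)"
    by (intro has_sum_cmult_left has_sum_cylinder tt)
  have h3: "(cyl_weight tt' \<circ> (\<lambda>xs. xs @ [j'])) xs = cyl_weight tt xs * trans_fun Q (T - tt n) j j'"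
    if "xs \<in> cylinder S n" for xs
  proof -
    have len: "length xs = Suc n" and last: "xs ! n = j" using that S by (auto simp: cylinder_def)
    have "(\<Prod>l<n. trans_fun Q (tt' (Suc l) - tt' l) ((xs @ [j']) ! l) ((xs @ [j']) ! Suc l))
        = (\<Prod>l<n. trans_fun Q (tt (Suc l) - tt l) (xs ! l) (xs ! Suc l))"
      using len by (intro prod.cong) (auto simp: tt'_def nth_append)
    then show ?thesis using len last by (simp add: cyl_weight_def tt'_def nth_append)
  qed
  show ?thesis
    by (rule has_sum_unique[OF has_sum_cong[THEN iffD1, OF h3 h1] h2])
qed

section \<open>The law at a fixed time and its Taylor expansion\<close>

lemma has_sum_prob_at:
  assumes "0 \<le> t"
  shows "((\<lambda>i. \<rho> i * trans_fun Q t i j) has_sum prob {\<omega>\<in>space M. Y t \<omega> = j}) UNIV"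
proof -
  define A where "A = (\<lambda>i. {\<omega>\<in>space M. Y 0 \<omega> = i \<and> Y t \<omega> = j})"
  have "((\<lambda>i. prob (A i)) has_sum prob (\<Union>i. A i)) UNIV"
    by (rule has_sum_measure_UN) (auto simp: A_def disjoint_family_on_def)
  moreover have "(\<Union>i. A i) = {\<omega>\<in>space M. Y t \<omega> = j}" by (auto simp: A_def)
  moreover have "prob (A i) = \<rho> i * trans_fun Q t i j" for i
  proof -
    have "A i = {\<omega>\<in>space M. \<forall>l\<le>(1::nat). Y (if l = 0 then 0 else t) \<omega> = (if l = 0 then i else j)}"
      by (auto simp: A_def le_Suc_eq)
    also have "prob \<dots> = \<rho> (if (0::nat) = 0 then i else j) * (\<Prod>l<1. trans_fun Q
        ((if Suc l = 0 then 0 else t) - (if l = 0 then 0 else t)) (if l = 0 then i else j) (if Suc l = 0 then i else j))"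
      by (rule Y_fdd) (use assms in auto)
    finally show ?thesis by simp
  qed
  ultimately show ?thesis by simp
qed

text \<open>The error in \<open>trans_fun_expansion\<close> is independent of the initial state, so
  averaging over \<rho> preserves it.\<close>

lemma prob_at_expansion:
  assumes "0 \<le> t"
  shows "\<bar>prob {\<omega>\<in>space M. Y t \<omega> = j} - (\<Sum>k<n. t ^ k / fact k * deriv_mass k j)\<bar>
    \<le> (2 * C * t) ^ n * exp (2 * C * t)"
proof -
  define E where "E = (2 * C * t) ^ n * exp (2 * C * t)"
  define h where "h = (\<lambda>i. \<rho> i * trans_fun Q t i j - (\<Sum>k<n. t ^ k / fact k * (\<rho> i * qpow Q k i j)))"
  have s: "((\<lambda>i. \<Sum>k<n. t ^ k / fact k * (\<rho> i * qpow Q k i j)) has_sum (\<Sum>k<n. t ^ k / fact k * deriv_mass k j)) UNIV"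
    by (rule has_sum_sum_finite[OF finite_lessThan], rule has_sum_cmult_right, rule has_sum_deriv_mass)
  have h: "(h has_sum (prob {\<omega>\<in>space M. Y t \<omega> = j} - (\<Sum>k<n. t ^ k / fact k * deriv_mass k j))) UNIV"
    using has_sum_add[OF has_sum_prob_at[OF assms] has_sum_uminusI[OF s]] by (simp add: h_def)
  have E: "((\<lambda>i. \<rho> i * E) has_sum 1 * E) UNIV"
    by (intro has_sum_cmult_left \<rho>_sum)
  have "\<bar>h i\<bar> \<le> \<rho> i * E" for i
  proof -
    have "h i = \<rho> i * (trans_fun Q t i j - (\<Sum>k<n. t ^ k / fact k * qpow Q k i j))"
      by (simp add: h_def right_diff_distrib sum_distrib_left mult_ac)
    then show ?thesis
      using mult_left_mono[OF trans_fun_expansion[OF assms] \<rho>_nonneg] \<rho>_nonneg[of i]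
      by (simp add: abs_mult E_def)
  qed
  then have "h i \<le> \<rho> i * E" "- h i \<le> \<rho> i * E" for i by (auto simp: abs_le_iff)
  from has_sum_mono[OF h E this(1)] has_sum_mono[OF has_sum_uminusI[OF h] E this(2)]
  show ?thesis unfolding E_def by (simp add: abs_le_iff)
qed

lemma prob_at_unreachable:
  assumes "0 \<le> t" "depth j = \<infinity>"
  shows "prob {\<omega>\<in>space M. Y t \<omega> = j} = 0"
proof -
  have "\<rho> i * trans_fun Q t i j = 0" for i
  proof (cases "\<rho> i = 0")
    case False
    then have "qpow Q k i j = 0" for k using init_qpow_eq_0[of k j i] assms by simp
    then show ?thesis by (simp add: trans_fun_def)
  qed simp
  then have "(\<Sum>\<^sub>\<infinity>i. \<rho> i * trans_fun Q t i j) = 0" by (intro infsum_0)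
  then show ?thesis using infsumI[OF has_sum_prob_at[OF assms(1), of j]] by simp
qed

section \<open>Hitting events and their approximation on dyadic grids\<close>

definition hit :: "'i set \<Rightarrow> real \<Rightarrow> 'a set" where
  "hit J t = {\<omega>\<in>space M. \<exists>s. 0 \<le> s \<and> s \<le> t \<and> Y s \<omega> \<in> J}"

text \<open>Dyadic grids are nested, so the events increase with \<open>n\<close>. The index 2^n is
  included because right-constancy cannot transfer a visit at the final time \<open>t\<close> to
  another point of the interval.\<close>

definition grid_hit :: "'i set \<Rightarrow> real \<Rightarrow> nat \<Rightarrow> 'a set" where
  "grid_hit J t n = {\<omega>\<in>space M. \<exists>l\<le>2 ^ n. Y (t * real l / 2 ^ n) \<omega> \<in> J}"

lemma grid_hit_sets[measurable]: "grid_hit J t n \<in> sets M"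
  unfolding grid_hit_def by measurable

lemma incseq_grid_hit: "incseq (grid_hit J t)"
proof (rule incseq_SucI, rule subsetI)
  fix n \<omega> assume "\<omega> \<in> grid_hit J t n"
  then obtain l where l: "\<omega> \<in> space M" "l \<le> 2 ^ n" "Y (t * real l / 2 ^ n) \<omega> \<in> J"
    by (auto simp: grid_hit_def)
  then show "\<omega> \<in> grid_hit J t (Suc n)"
    unfolding grid_hit_def by (auto intro!: exI[of _ "2 * l"])
qed

end

text \<open>A visit at \<open>s < t\<close> lasts for some time to the right of \<open>s\<close>,
  and a fine enough grid has a point there; \<open>s = t\<close> is itself a grid point. This
  replaces an uncountable union by a countable one.\<close>

lemma right_const_hits_dyadic:
  fixes y :: "real \<Rightarrow> 'b"
  assumes right_const: "\<And>s. 0 \<le> s \<Longrightarrow> \<exists>\<epsilon>>0. \<forall>r. s \<le> r \<and> r < s + \<epsilon> \<longrightarrow> y r = y s"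
    and t: "0 \<le> t"
  shows "(\<exists>s. 0 \<le> s \<and> s \<le> t \<and> y s \<in> J) \<longleftrightarrow> (\<exists>n. \<exists>l\<le>2 ^ n. y (t * real l / 2 ^ n) \<in> J)"
proof
  assume "\<exists>n. \<exists>l\<le>2 ^ n. y (t * real l / 2 ^ n) \<in> J"
  then obtain n l where l: "l \<le> 2 ^ n" "y (t * real l / 2 ^ n) \<in> J" by auto
  have "real l \<le> 2 ^ n" using l(1) by (metis of_nat_le_iff of_nat_numeral of_nat_power)
  then have "t * real l / 2 ^ n \<le> t" using t by (simp add: divide_le_eq mult_left_mono)
  with l t show "\<exists>s. 0 \<le> s \<and> s \<le> t \<and> y s \<in> J"
    by (intro exI[of _ "t * real l / 2 ^ n"]) auto
next
  assume "\<exists>s. 0 \<le> s \<and> s \<le> t \<and> y s \<in> J"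
  then obtain s where s: "0 \<le> s" "s \<le> t" "y s \<in> J" by auto
  show "\<exists>n. \<exists>l\<le>2 ^ n. y (t * real l / 2 ^ n) \<in> J"
  proof (cases "s = t")
    case True
    then show ?thesis using s by (intro exI[of _ 0] exI[of _ 1]) auto
  next
    case False
    with s have st: "s < t" by simp
    obtain \<epsilon> where \<epsilon>: "0 < \<epsilon>" "\<And>r. s \<le> r \<Longrightarrow> r < s + \<epsilon> \<Longrightarrow> y r = y s"
      using right_const[OF s(1)] by blast
    obtain n where n: "t / \<epsilon> < 2 ^ n" using real_arch_pow[of 2 "t / \<epsilon>"] by auto
    \<comment> \<open>The first grid point at or after \<open>s\<close>; it overshoots
      \<open>s\<close> by less than the mesh t / 2^n, which is below \<epsilon>.\<close>
    define l where "l = nat \<lceil>s * 2 ^ n / t\<rceil>"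
    have x0: "0 \<le> s * 2 ^ n / t" using s st by simp
    have l: "s * 2 ^ n / t \<le> real l" "real l < s * 2 ^ n / t + 1"
      using x0 ceiling_correct[of "s * 2 ^ n / t"] by (auto simp: l_def)
    have "s * 2 ^ n / t \<le> 2 ^ n" using s st by (simp add: divide_le_eq)
    then have "\<lceil>s * 2 ^ n / t\<rceil> \<le> 2 ^ n" by (simp add: ceiling_le_iff)
    then have "l \<le> 2 ^ n" by (simp add: l_def nat_le_iff)
    moreover have "y (t * real l / 2 ^ n) = y s"
    proof (rule \<epsilon>(2))
      show "s \<le> t * real l / 2 ^ n" using l(1) s st by (simp add: field_simps)
      have "t * real l / 2 ^ n < t * (s * 2 ^ n / t + 1) / 2 ^ n"
        using l(2) s st by (intro divide_strict_right_mono mult_strict_left_mono) auto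
      also have "\<dots> = s + t / 2 ^ n" using s st by (simp add: field_simps)
      also have "\<dots> \<le> s + \<epsilon>" using n \<epsilon>(1) by (simp add: field_simps)
      finally show "t * real l / 2 ^ n < s + \<epsilon>" .
    qed
    ultimately show ?thesis using s(3) by (intro exI[of _ n] exI[of _ l]) simp
  qed
qed

context ctmc
begin

lemma hit_eq_UN_grid_hit:
  assumes "0 \<le> t"
  shows "hit J t = (\<Union>n. grid_hit J t n)"
proof -
  have "(\<exists>s. 0 \<le> s \<and> s \<le> t \<and> Y s \<omega> \<in> J) \<longleftrightarrow> (\<exists>n. \<exists>l\<le>2 ^ n. Y (t * real l / 2 ^ n) \<omega> \<in> J)"
    if "\<omega> \<in> space M" for \<omega>
  proof (rule right_const_hits_dyadic[OF _ assms])
    fix s :: real assume "0 \<le> s"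
    then show "\<exists>\<epsilon>>0. \<forall>r. s \<le> r \<and> r < s + \<epsilon> \<longrightarrow> Y r \<omega> = Y s \<omega>"
      using ctmc that by (auto simp: is_ctmc_def)
  qed
  then have "\<omega> \<in> hit J t \<longleftrightarrow> \<omega> \<in> (\<Union>n. grid_hit J t n)" for \<omega>
    by (cases "\<omega> \<in> space M") (simp_all add: hit_def grid_hit_def)
  then show ?thesis by blast
qed

lemma hit_empty: "t < 0 \<Longrightarrow> hit J t = {}"
  by (auto simp: hit_def)

lemma hit_sets[measurable]: "hit J t \<in> sets M"
  by (cases "t < 0") (auto simp: hit_empty hit_eq_UN_grid_hit)

lemma hit_mono: "s \<le> t \<Longrightarrow> hit J s \<subseteq> hit J t"
  by (force simp: hit_def)

lemma grid_hit_limit: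
  assumes "0 \<le> t"
  shows "(\<lambda>n. prob (grid_hit J t n)) \<longlonglongrightarrow> prob (hit J t)"
  unfolding hit_eq_UN_grid_hit[OF assms]
  by (intro finite_Lim_measure_incseq incseq_grid_hit) auto

lemma prob_hit_ge: "0 \<le> t \<Longrightarrow> prob {\<omega>\<in>space M. Y t \<omega> \<in> J} \<le> prob (hit J t)"
  by (intro finite_measure_mono hit_sets) (auto simp: hit_def)

text \<open>A chain sitting in \<open>j\<close> at the first grid time that sees \<open>J\<close> is still there at time \<open>t\<close> with
  conditional probability close to 1, uniformly in \<open>j\<close>.\<close>

lemma prob_grid_hit_le:
  assumes t: "0 \<le> t" and J: "finite J"
  shows "(1 - 2 * C * t * exp (2 * C * t)) * prob (grid_hit J t n) \<le> prob {\<omega>\<in>space M. Y t \<omega> \<in> J}"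
proof -
  define c where "c = 1 - 2 * C * t * exp (2 * C * t)"
  define tt where "tt = (\<lambda>r. t * real r / 2 ^ n)"
  define S where "S = (\<lambda>(l::nat) j r. if r = l then {j} else - J)"
  \<comment> \<open>\<open>E (l, j)\<close>, for \<open>j\<close> in \<open>J\<close>: the first
    grid visit to \<open>J\<close> happens at index \<open>l\<close> and in state \<open>j\<close>.
    \<open>F (l, j)\<close> also asks for state \<open>j\<close> at the final time.\<close>
  define E where "E = (\<lambda>(l, j). {\<omega>\<in>space M. \<forall>r\<le>l. Y (tt r) \<omega> \<in> S l j r})"
  define F where "F = (\<lambda>(l, j). {\<omega>\<in>space M. (\<forall>r\<le>l. Y (tt r) \<omega> \<in> S l j r) \<and> Y t \<omega> = j})"
  define I where "I = {..(2::nat) ^ n} \<times> J"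
  have I: "finite I" using J by (simp add: I_def)
  have ES: "E x \<in> sets M" and FS: "F x \<in> sets M" for x
    by (cases x; simp add: E_def F_def; measurable)+
  have disj: "E x \<inter> E y = {}" if xy: "x \<in> I" "y \<in> I" "x \<noteq> y" for x y
  proof (rule ccontr)
    assume "E x \<inter> E y \<noteq> {}"
    moreover obtain l j l' j' where [simp]: "x = (l, j)" "y = (l', j')" by (cases x; cases y)
    ultimately obtain \<omega> where
      \<omega>: "\<And>r. r \<le> l \<Longrightarrow> Y (tt r) \<omega> \<in> S l j r" "\<And>r. r \<le> l' \<Longrightarrow> Y (tt r) \<omega> \<in> S l' j' r"
      by (auto simp: E_def)
    have "l = l'"
    proof (rule linorder_cases[of l l'])
      assume "l < l'"
      then show ?thesis using \<omega>(1)[of l] \<omega>(2)[of l] xy by (auto simp: S_def I_def)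
    next
      assume "l' < l"
      then show ?thesis using \<omega>(1)[of l'] \<omega>(2)[of l'] xy by (auto simp: S_def I_def)
    qed
    moreover from this have "j = j'" using \<omega>(1)[of l] \<omega>(2)[of l] by (auto simp: S_def)
    ultimately show False using xy by simp
  qed
  have FE: "F x \<subseteq> E x" for x by (cases x) (auto simp: E_def F_def)
  have UE: "grid_hit J t n = (\<Union>x\<in>I. E x)"
  proof (intro equalityI subsetI)
    fix \<omega> assume "\<omega> \<in> grid_hit J t n"
    then have \<omega>: "\<omega> \<in> space M" "\<exists>l. l \<le> 2 ^ n \<and> Y (tt l) \<omega> \<in> J"
      by (auto simp: grid_hit_def tt_def)
    define l where "l = (LEAST l. l \<le> 2 ^ n \<and> Y (tt l) \<omega> \<in> J)"
    have l: "l \<le> 2 ^ n" "Y (tt l) \<omega> \<in> J" using LeastI_ex[OF \<omega>(2)] by (auto simp: l_def)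
    have "Y (tt r) \<omega> \<notin> J" if "r < l" for r
      using not_less_Least[of r "\<lambda>l. l \<le> 2 ^ n \<and> Y (tt l) \<omega> \<in> J"] that l(1) by (auto simp: l_def)
    then have "\<omega> \<in> E (l, Y (tt l) \<omega>)" using \<omega>(1) by (auto simp: E_def S_def)
    with l show "\<omega> \<in> (\<Union>x\<in>I. E x)" by (auto simp: I_def)
  next
    fix \<omega> assume "\<omega> \<in> (\<Union>x\<in>I. E x)"
    then obtain l j where lj: "l \<le> 2 ^ n" "j \<in> J" "\<omega> \<in> E (l, j)" by (auto simp: I_def)
    then have "\<omega> \<in> space M" "Y (tt l) \<omega> = j" by (auto simp: E_def S_def)
    then show "\<omega> \<in> grid_hit J t n" using lj by (auto simp: grid_hit_def tt_def)
  qed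
  have stay: "c * prob (E x) \<le> prob (F x)" if "x \<in> I" for x
  proof -
    obtain l j where x: "x = (l, j)" by (cases x)
    with that have "l \<le> 2 ^ n" by (simp add: I_def)
    then have "real l \<le> 2 ^ n" by (metis of_nat_le_iff of_nat_numeral of_nat_power)
    then have le: "tt l \<le> t" using t by (simp add: tt_def divide_le_eq mult_left_mono)
    have ttl: "0 \<le> tt l" using t by (simp add: tt_def)
    have "prob (F x) = prob (E x) * trans_fun Q (t - tt l) j j"
      unfolding x E_def F_def prod.case
      by (rule markov_step) (use t le in \<open>auto simp: tt_def S_def divide_right_mono mult_left_mono\<close>)
    \<comment> \<open>Replacing the remaining time by the whole of \<open>t\<close> removes the
      dependence on \<open>l\<close>, so one constant \<open>c\<close> serves all cases and factors
      out of the sum.\<close>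
    moreover have stay_prob: "c \<le> trans_fun Q (t - tt l) j j"
    proof -
      have "1 - trans_fun Q (t - tt l) j j \<le> 2 * C * (t - tt l) * exp (2 * C * (t - tt l))"
        using trans_fun_expansion[of "t - tt l" j j 1] le by simp
      also have "\<dots> \<le> 2 * C * t * exp (2 * C * t)"
        using C_nonneg le ttl t by (intro mult_mono) (auto intro!: mult_left_mono)
      finally show ?thesis by (simp add: c_def)
    qed
    ultimately show ?thesis
      using mult_right_mono[OF stay_prob measure_nonneg[of M "E x"]] by (simp add: mult.commute)
  qed
  have "c * prob (grid_hit J t n) = c * (\<Sum>x\<in>I. prob (E x))"
    unfolding UE using I ES disj
    by (subst finite_measure_finite_Union) (auto simp: disjoint_family_on_def)
  also have "\<dots> = (\<Sum>x\<in>I. c * prob (E x))" by (rule sum_distrib_left)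
  also have "\<dots> \<le> (\<Sum>x\<in>I. prob (F x))" by (intro sum_mono stay)
  also have "\<dots> = prob (\<Union>x\<in>I. F x)"
  proof (rule finite_measure_finite_Union[OF I, symmetric])
    have "F x \<inter> F y = {}" if "x \<in> I" "y \<in> I" "x \<noteq> y" for x y
      using disj[OF that] FE[of x] FE[of y] by blast
    then show "disjoint_family_on F I" by (simp add: disjoint_family_on_def)
  qed (use FS in auto)
  also have "\<dots> \<le> prob {\<omega>\<in>space M. Y t \<omega> \<in> J}"
    by (intro finite_measure_mono) (auto simp: F_def I_def)
  finally show ?thesis by (simp add: c_def)
qed

lemma prob_hit_le:
  assumes "0 \<le> t" "finite J"
  shows "(1 - 2 * C * t * exp (2 * C * t)) * prob (hit J t) \<le> prob {\<omega>\<in>space M. Y t \<omega> \<in> J}"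
  by (rule LIMSEQ_le_const2[OF tendsto_mult[OF tendsto_const grid_hit_limit]])
     (use assms prob_grid_hit_le in auto)

text \<open>Each fixed time contributes probability 0, hence so does each finite grid, and the grids
  exhaust the hitting event.\<close>

lemma prob_hit_unreachable:
  assumes "depth j = \<infinity>"
  shows "prob (hit {j} t) = 0"
proof (cases "t < 0")
  case False
  have "prob (grid_hit {j} t n) \<le> (\<Sum>l\<le>2 ^ n. prob {\<omega>\<in>space M. Y (t * real l / 2 ^ n) \<omega> = j})" for n
  proof -
    have "grid_hit {j} t n = (\<Union>l\<in>{..2 ^ n}. {\<omega>\<in>space M. Y (t * real l / 2 ^ n) \<omega> = j})"
      by (auto simp: grid_hit_def)
    then show ?thesis by (auto intro!: finite_measure_subadditive_finite)
  qed
  then have "prob (grid_hit {j} t n) = 0" for n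
    using prob_at_unreachable[OF _ assms] False by (simp add: measure_le_0_iff)
  then show ?thesis using grid_hit_limit[of t "{j}"] False by (simp add: LIMSEQ_const_iff)
qed (simp add: hit_empty)

text \<open>The hitting probability lies between \<open>P t\<close> and \<open>P t / c t\<close>
  with \<open>c t\<close> tending to 1. Since \<open>d\<close> is only a lower bound for the depths,
  sets of mixed depth are covered: deeper states enter the limit with coefficient 0.\<close>

lemma prob_hit_asymptotics:
  assumes J: "finite J" and d: "\<And>j. j \<in> J \<Longrightarrow> enat d \<le> depth j"
  shows "((\<lambda>t. prob (hit J t) / t ^ d) \<longlongrightarrow> (\<Sum>j\<in>J. deriv_mass d j) / fact d) (at_right 0)"
proof -
  define P where "P = (\<lambda>t. prob {\<omega>\<in>space M. Y t \<omega> \<in> J})"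
  \<comment> \<open>The expansion is taken one order beyond \<open>d\<close>, so that a factor
    \<open>t\<close> survives in the remainder after division by t^d.\<close>
  have one: "((\<lambda>t. prob {\<omega>\<in>space M. Y t \<omega> = j} / t ^ d) \<longlongrightarrow> deriv_mass d j / fact d) (at_right 0)"
    if "j \<in> J" for j
  proof (rule Lim_transform[OF tendsto_const], rule tendsto_0_le[where K = 1])
    show "((\<lambda>t. (2 * C) ^ Suc d * t * exp (2 * C * t)) \<longlongrightarrow> 0) (at_right 0)"
      by (auto intro!: tendsto_eq_intros)
    show "\<forall>\<^sub>F t in at_right 0. norm (prob {\<omega>\<in>space M. Y t \<omega> = j} / t ^ d - deriv_mass d j / fact d)
        \<le> norm ((2 * C) ^ Suc d * t * exp (2 * C * t)) * 1"
      using eventually_at_right_less[of 0]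
    proof eventually_elim
      case (elim t)
      have "(\<Sum>k<Suc d. t ^ k / fact k * deriv_mass k j) = t ^ d / fact d * deriv_mass d j"
      proof -
        have "deriv_mass k j = 0" if "k < d" for k
        proof (rule deriv_mass_eq_0)
          have "enat k < enat d" using that by simp
          also have "\<dots> \<le> depth j" by (rule d) fact
          finally show "enat k < depth j" .
        qed
        then show ?thesis by simp
      qed
      then have "\<bar>prob {\<omega>\<in>space M. Y t \<omega> = j} - t ^ d / fact d * deriv_mass d j\<bar>
          \<le> (2 * C * t) ^ Suc d * exp (2 * C * t)"
        using prob_at_expansion[of t j "Suc d"] elim by simp
      then have "\<bar>prob {\<omega>\<in>space M. Y t \<omega> = j} - t ^ d / fact d * deriv_mass d j\<bar> / t ^ d
          \<le> (2 * C * t) ^ Suc d * exp (2 * C * t) / t ^ d"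
        using elim by (intro divide_right_mono) auto
      also have "(2 * C * t) ^ Suc d * exp (2 * C * t) / t ^ d = (2 * C) ^ Suc d * t * exp (2 * C * t)"
        using elim by (simp add: power_mult_distrib)
      also have "\<bar>prob {\<omega>\<in>space M. Y t \<omega> = j} - t ^ d / fact d * deriv_mass d j\<bar> / t ^ d
          = \<bar>prob {\<omega>\<in>space M. Y t \<omega> = j} / t ^ d - deriv_mass d j / fact d\<bar>"
      proof -
        have "(prob {\<omega>\<in>space M. Y t \<omega> = j} - t ^ d / fact d * deriv_mass d j) / t ^ d
            = prob {\<omega>\<in>space M. Y t \<omega> = j} / t ^ d - deriv_mass d j / fact d"
          using elim by (simp add: diff_divide_distrib)
        moreover have "\<bar>x\<bar> / t ^ d = \<bar>x / t ^ d\<bar>" for x using elim by (simp add: abs_divide)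
        ultimately show ?thesis by (simp only:)
      qed
      finally show ?case
        using C_nonneg elim by simp
    qed
  qed
  have "P t / t ^ d = (\<Sum>j\<in>J. prob {\<omega>\<in>space M. Y t \<omega> = j} / t ^ d)" for t
  proof -
    have "{\<omega>\<in>space M. Y t \<omega> \<in> J} = (\<Union>j\<in>J. {\<omega>\<in>space M. Y t \<omega> = j})" by auto
    then have "P t = (\<Sum>j\<in>J. prob {\<omega>\<in>space M. Y t \<omega> = j})"
      unfolding P_def using J
      by (subst finite_measure_finite_Union[symmetric]) (auto simp: disjoint_family_on_def)
    then show ?thesis by (simp add: sum_divide_distrib)
  qed
  then have limP: "((\<lambda>t. P t / t ^ d) \<longlongrightarrow> (\<Sum>j\<in>J. deriv_mass d j) / fact d) (at_right 0)"
    unfolding sum_divide_distrib by (simp add: tendsto_sum one)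
  define c where "c = (\<lambda>t. 1 - 2 * C * t * exp (2 * C * t))"
  have limc: "(c \<longlongrightarrow> 1) (at_right 0)"
    unfolding c_def by (auto intro!: tendsto_eq_intros)
  have hi: "((\<lambda>t. P t / t ^ d / c t) \<longlongrightarrow> (\<Sum>j\<in>J. deriv_mass d j) / fact d / 1) (at_right 0)"
    by (intro tendsto_divide limP limc) simp
  show ?thesis
  proof (rule tendsto_sandwich[OF _ _ limP])
    show "\<forall>\<^sub>F t in at_right 0. P t / t ^ d \<le> prob (hit J t) / t ^ d"
      using eventually_at_right_less[of 0]
      by eventually_elim (auto simp: P_def intro!: divide_right_mono prob_hit_ge)
    have "\<forall>\<^sub>F t in at_right 0. 0 < c t" using order_tendstoD(1)[OF limc, of 0] by simp
    then show "\<forall>\<^sub>F t in at_right 0. prob (hit J t) / t ^ d \<le> P t / t ^ d / c t"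
      using eventually_at_right_less[of 0]
    proof eventually_elim
      case (elim t)
      have "prob (hit J t) \<le> P t / c t"
        using prob_hit_le[of t J] J elim by (simp add: P_def c_def pos_le_divide_eq mult.commute)
      then have "prob (hit J t) / t ^ d \<le> P t / c t / t ^ d"
        using elim by (intro divide_right_mono) auto
      then show ?case by (simp add: mult.commute)
    qed
  qed (use hi in simp)
qed

end

text \<open>Avoiding \<open>J\<close> on a grid has a probability given by a sum over lists that
  involves only \<open>Q\<close> and \<rho>; uniqueness of sums and the grid limit do the rest. This
  shows that all searchers share one hitting law.\<close>

lemma prob_hit_cong:
  assumes Y: "ctmc Q C \<rho> M Y" and Z: "ctmc Q C \<rho> M' Z"
  shows "measure M (ctmc.hit M Y J t) = measure M' (ctmc.hit M' Z J t)"
proof (cases "t < 0")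
  case True
  then show ?thesis by (simp add: ctmc.hit_empty[OF Y] ctmc.hit_empty[OF Z])
next
  case False
  interpret Y: ctmc Q C \<rho> M Y by (rule Y)
  interpret Z: ctmc Q C \<rho> M' Z by (rule Z)
  have "Y.prob (Y.grid_hit J t n) = Z.prob (Z.grid_hit J t n)" for n
  proof -
    define tt where "tt = (\<lambda>r. t * real r / 2 ^ n)"
    have tt: "tt 0 = 0" "\<And>l. l < 2 ^ n \<Longrightarrow> tt l \<le> tt (Suc l)"
      using False by (auto simp: tt_def divide_right_mono mult_left_mono)
    have "Y.prob {\<omega>\<in>space M. \<forall>r\<le>2 ^ n. Y (tt r) \<omega> \<in> - J} = Z.prob {\<omega>\<in>space M'. \<forall>r\<le>2 ^ n. Z (tt r) \<omega> \<in> - J}"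
      using Y.has_sum_cylinder[where S = "\<lambda>_. - J", OF tt] Z.has_sum_cylinder[where S = "\<lambda>_. - J", OF tt]
      unfolding Y.cylinder_def Z.cylinder_def Y.cyl_weight_def[abs_def] Z.cyl_weight_def[abs_def]
      by (rule has_sum_unique)
    moreover have "Y.grid_hit J t n = space M - {\<omega>\<in>space M. \<forall>r\<le>2 ^ n. Y (tt r) \<omega> \<in> - J}"
      by (auto simp: Y.grid_hit_def tt_def)
    moreover have "Z.grid_hit J t n = space M' - {\<omega>\<in>space M'. \<forall>r\<le>2 ^ n. Z (tt r) \<omega> \<in> - J}"
      by (auto simp: Z.grid_hit_def tt_def)
    ultimately show ?thesis by (simp add: Y.prob_compl Z.prob_compl)
  qed
  then show ?thesis
    using Y.grid_hit_limit[of t J] Z.grid_hit_limit[of t J] False LIMSEQ_unique by simp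
qed

section \<open>Moments of high powers of a survival function\<close>

lemma one_minus_pow_le_exp:
  fixes y :: real
  assumes "y \<le> 1"
  shows "(1 - y) ^ n \<le> exp (- (real n * y))"
proof -
  have "(1 - y) ^ n \<le> exp (- y) ^ n"
    using assms exp_ge_add_one_self[of "- y"] by (intro power_mono) auto
  then show ?thesis by (simp add: exp_of_nat_mult[symmetric])
qed

text \<open>Convergence of n y_n forces y_n to 0, so eventually ln(1 - y) \<ge> - y - 2 y^2 applies.
  Multiplied by \<open>n\<close>, the quadratic error is 2 (n y_n) y_n and vanishes.\<close>

lemma tendsto_one_minus_pow:
  fixes y :: "nat \<Rightarrow> real"
  assumes y: "\<And>n. 0 \<le> y n" and lim: "(\<lambda>n. real n * y n) \<longlonglongrightarrow> c"
  shows "(\<lambda>n. (1 - y n) ^ n) \<longlonglongrightarrow> exp (- c)"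
proof -
  have "(\<lambda>n. real n * y n * (1 / real n)) \<longlonglongrightarrow> c * 0"
    by (intro tendsto_mult lim lim_1_over_n)
  moreover have "\<forall>\<^sub>F n in sequentially. real n * y n * (1 / real n) = y n"
    using eventually_gt_at_top[of 0] by eventually_elim simp
  ultimately have y0: "y \<longlonglongrightarrow> 0"
    using Lim_transform_eventually by fastforce
  have small: "\<forall>\<^sub>F n in sequentially. y n \<le> 1 / 2"
    using order_tendstoD(2)[OF y0, of "1/2"] by (auto elim: eventually_mono)
  have lo: "(\<lambda>n. exp (- (real n * y n) - 2 * (real n * y n) * y n)) \<longlonglongrightarrow> exp (- c - 2 * c * 0)"
    by (intro tendsto_intros lim y0)
  have hi: "(\<lambda>n. exp (- (real n * y n))) \<longlonglongrightarrow> exp (- c)"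
    by (intro tendsto_intros lim)
  have pow: "exp (real n * z) = exp z ^ n" for n z
    by (simp add: exp_of_nat_mult)
  show ?thesis
  proof (rule tendsto_sandwich)
    show "\<forall>\<^sub>F n in sequentially. exp (- (real n * y n) - 2 * (real n * y n) * y n) \<le> (1 - y n) ^ n"
      using small
    proof eventually_elim
      case (elim n)
      have "exp (- y n - 2 * (y n)\<^sup>2) \<le> exp (ln (1 - y n))"
        using ln_one_minus_pos_lower_bound[of "y n"] y[of n] elim by (simp only: exp_le_cancel_iff)
      then have "exp (- y n - 2 * (y n)\<^sup>2) \<le> 1 - y n"
        using elim by simp
      then have "exp (- y n - 2 * (y n)\<^sup>2) ^ n \<le> (1 - y n) ^ n"
        using elim by (intro power_mono) auto
      then show ?case
        by (simp add: pow[symmetric] algebra_simps power2_eq_square)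
    qed
    show "\<forall>\<^sub>F n in sequentially. (1 - y n) ^ n \<le> exp (- (real n * y n))"
      using small by eventually_elim (auto intro!: one_minus_pow_le_exp)
  qed (use lo hi in auto)
qed

lemma bounded_powr_mult_power:
  fixes \<gamma> q :: real
  assumes "0 < \<gamma>" "\<gamma> < 1"
  shows "\<exists>B. \<forall>n. real n powr q * \<gamma> ^ n \<le> B"
proof -
  have "(\<lambda>n. real n powr q * exp (real n * ln \<gamma>)) \<longlonglongrightarrow> 0"
  proof -
    have "ln \<gamma> < 0" using assms by simp
    then show ?thesis by real_asymp
  qed
  then have "(\<lambda>n. real n powr q * \<gamma> ^ n) \<longlonglongrightarrow> 0"
    using assms by (simp add: exp_of_nat_mult)
  then have "Bseq (\<lambda>n. real n powr q * \<gamma> ^ n)"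
    by (intro convergent_imp_Bseq convergentI)
  then obtain B where "\<And>n. norm (real n powr q * \<gamma> ^ n) \<le> B"
    unfolding Bseq_def by blast
  then show ?thesis by (auto intro!: exI[of _ B] dest: abs_le_D1)
qed

text \<open>Far out the product is below 1, and on the remaining compact interval it is bounded by
  continuity. Trading exponential for polynomial decay gives both regimes of
  \<open>power_tail_bound\<close> the same shape.\<close>

lemma powr_mult_exp_bounded:
  fixes c q :: real
  assumes "0 < c"
  shows "\<exists>B\<ge>0. \<forall>s\<ge>1. exp (- c * s) \<le> B * s powr (- q)"
proof -
  have "((\<lambda>s. s powr q * exp (- c * s)) \<longlongrightarrow> 0) at_top"
    using assms by real_asymp
  then have "\<forall>\<^sub>F s in at_top. s powr q * exp (- c * s) < 1"
    by (rule order_tendstoD) simp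
  then obtain s0 where s0: "\<And>s. s \<ge> s0 \<Longrightarrow> s powr q * exp (- c * s) < 1"
    by (auto simp: eventually_at_top_linorder)
  have "continuous_on {1..max 1 s0} (\<lambda>s. s powr q * exp (- c * s))"
    by (intro continuous_intros) auto
  then have "bounded ((\<lambda>s. s powr q * exp (- c * s)) ` {1..max 1 s0})"
    by (intro compact_imp_bounded compact_continuous_image) auto
  then obtain B where B: "\<And>s. s \<in> {1..max 1 s0} \<Longrightarrow> \<bar>s powr q * exp (- c * s)\<bar> \<le> B"
    unfolding bounded_iff real_norm_def by blast
  have "exp (- c * s) \<le> max 1 B * s powr (- q)" if "1 \<le> s" for s
  proof -
    have "s powr q * exp (- c * s) \<le> max 1 B"
      using s0[of s] B[of s] that by (cases "s \<ge> s0") auto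
    then have "s powr q * exp (- c * s) * s powr (-q) \<le> max 1 B * s powr (- q)"
      by (rule mult_right_mono) simp
    moreover have "s powr q * exp (- c * s) * s powr (-q) = exp (- c * s)"
      using that by (simp add: powr_minus)
    ultimately show ?thesis by linarith
  qed
  then show ?thesis by (intro exI[of _ "max 1 B"]) auto
qed

lemma has_bochner_integral_of_has_integral:
  fixes f :: "real \<Rightarrow> real"
  assumes [measurable]: "f \<in> borel_measurable borel" "S \<in> sets borel"
    and nonneg: "\<And>x. x \<in> S \<Longrightarrow> 0 \<le> f x" and I: "(f has_integral I) S"
  shows "has_bochner_integral lborel (\<lambda>x. indicator S x * f x) I"
proof (rule has_bochner_integral_nn_integral)
  show "integral\<^sup>N lborel (\<lambda>x. ennreal (indicator S x * f x)) = ennreal I"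
    using nn_integral_has_integral_lebesgue[OF nonneg I] by simp
  show "0 \<le> I" using has_integral_nonneg[OF I] nonneg by auto
qed (use nonneg in \<open>auto simp: indicator_def\<close>)

text \<open>The tail exponent \<open>- (p + 1)\<close> is chosen so that multiplication by s^(p - 1)
  leaves s^(-2), whatever \<open>p\<close> is.\<close>

lemma integrable_powr_dominator:
  fixes p K :: real
  assumes "0 < p" "0 \<le> K"
  shows "integrable lborel
    (\<lambda>s. indicator {0<..} s * (p * s powr (p - 1) * (if s \<le> 1 then 1 else K * s powr (- (p + 1)))))"
proof -
  have a: "integrable lborel (\<lambda>s. indicator {0..1} s * s powr (p - 1))"
    using has_bochner_integral_of_has_integral[OF _ _ _ has_integral_powr_from_0[of "p - 1" 1]] assms
    by (auto simp: has_bochner_integral_iff)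
  have b: "integrable lborel (\<lambda>s. indicator {1..} s * s powr (- 2 :: real))"
    using has_bochner_integral_of_has_integral[OF _ _ _ has_integral_powr_to_inf[of "-2" 1]]
    by (auto simp: has_bochner_integral_iff)
  have "integrable lborel (\<lambda>s. p * (indicator {0..1} s * s powr (p - 1)) + p * K * (indicator {1..} s * s powr (- 2)))"
    using a b by (intro Bochner_Integration.integrable_add integrable_mult_right)
  then show ?thesis
  proof (rule Bochner_Integration.integrable_bound)
    have "indicator {0<..} s * (p * s powr (p - 1) * (if s \<le> 1 then 1 else K * s powr (- (p + 1))))
       \<le> p * (indicator {0..1} s * s powr (p - 1)) + p * K * (indicator {1..} s * s powr (- 2))" for s :: real
    proof -
      have "s powr (p - 1) * s powr (- (p + 1)) = s powr (- 2)"
        by (simp add: powr_add[symmetric])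
      then show ?thesis
        using assms by (auto simp: indicator_def mult_ac)
    qed
    then show "AE s in lborel. norm (indicator {0<..} s * (p * s powr (p - 1) * (if s \<le> 1 then 1 else K * s powr (- (p + 1)))))
       \<le> norm (p * (indicator {0..1} s * s powr (p - 1)) + p * K * (indicator {1..} s * s powr (- 2)))"
      using assms by (auto simp: abs_mult intro!: AE_I2 order_trans[OF _ abs_ge_self])
  qed auto
qed

text \<open>Euler's integral under the scaling \<open>a * u\<close>; the layer-cake factor
  \<open>p\<close> turns \<open>Gamma p\<close> into \<open>Gamma (1 + p)\<close>.\<close>

lemma has_bochner_integral_powr_exp:
  fixes a p :: real
  assumes "0 < a" "0 < p"
  shows "has_bochner_integral lborel
    (\<lambda>u. indicator {0<..} u * (p * u powr (p - 1) * exp (- (a * u)))) (Gamma (1 + p) * (1 / a) powr p)"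
proof -
  have "has_bochner_integral lborel (\<lambda>t. indicator {0..} t * (t powr (p - 1) / exp t)) (Gamma p)"
    using Gamma_integral_real[OF assms(2)] by (intro has_bochner_integral_of_has_integral) auto
  from has_bochner_integral_mult_right[OF this, of p]
  have *: "has_bochner_integral lborel (\<lambda>t. p * (indicator {0..} t * (t powr (p - 1) / exp t))) (Gamma (1 + p))"
    using Gamma_plus1[of p] assms by (simp add: nonpos_Ints_def add.commute)
  have "has_bochner_integral lborel (\<lambda>u. p * (indicator {0..} (0 + a * u) * ((0 + a * u) powr (p - 1) / exp (0 + a * u))))
     (Gamma (1 + p) /\<^sub>R \<bar>a\<bar>)"
    using * assms lborel_has_bochner_integral_real_affine_iff[of a _ _ 0] by fastforce
  from has_bochner_integral_mult_right[OF this, of "a powr (1 - p)"]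
  have "has_bochner_integral lborel (\<lambda>u. a powr (1 - p) * (p * (indicator {0..} (a * u) * ((a * u) powr (p - 1) / exp (a * u)))))
     (a powr (1 - p) * (Gamma (1 + p) / a))"
    using assms by (simp add: divide_inverse_commute)
  moreover have "a powr (1 - p) * (Gamma (1 + p) / a) = Gamma (1 + p) * (1 / a) powr p"
    using assms by (simp add: powr_diff powr_divide)
  moreover have "a powr (1 - p) * (p * (indicator {0..} (a * u) * ((a * u) powr (p - 1) / exp (a * u))))
     = indicator {0<..} u * (p * u powr (p - 1) * exp (- (a * u)))" for u
  proof (cases "u > 0")
    case True
    have "a powr (1 - p) * (a * u) powr (p - 1) = u powr (p - 1)"
      using assms True by (simp add: powr_mult powr_add[symmetric] flip: mult.assoc)
    then show ?thesis using True assms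
      by (simp add: exp_minus divide_inverse mult_ac indicator_def)
  next
    case False
    then show ?thesis using assms by (auto simp: indicator_def zero_le_mult_iff)
  qed
  ultimately show ?thesis by simp
qed

text \<open>Put x = s/N. For small x the limit at 0 gives 1 - H x \<ge> (a/2) x, hence decay exp(-
  (a/2) s). For x away from 0, \<open>k\<close> blocks of \<open>n0\<close> factors supply decay in
  x of order at least \<open>q\<close>, while the remaining factors are at most \<gamma> < 1 each
  and beat the power N^q that arises from x^(-q) = s^(-q) N^q.\<close>

lemma power_tail_bound:
  fixes H :: "real \<Rightarrow> real" and a \<theta> B \<beta> q :: real and n0 :: nat
  assumes H01: "\<And>u. 0 \<le> H u" "\<And>u. H u \<le> 1"
    and anti: "\<And>u v. 0 < u \<Longrightarrow> u \<le> v \<Longrightarrow> H v \<le> H u"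
    and lim: "((\<lambda>u. (1 - H u) / u powr \<theta>) \<longlongrightarrow> a) (at_right 0)"
    and a: "0 < a" and \<theta>: "\<theta> \<le> 1"
    and tail: "\<And>u. 0 < u \<Longrightarrow> H u ^ n0 \<le> B * u powr (- \<beta>)" and \<beta>: "0 < \<beta>"
  shows "\<exists>K D. 0 \<le> D \<and> (\<forall>N\<ge>K. \<forall>s\<ge>1. H (s / real N) ^ N \<le> D * s powr (- q))"
proof -
  have "\<forall>\<^sub>F u in at_right 0. a / 2 < (1 - H u) / u powr \<theta>"
    using lim a by (intro order_tendstoD) auto
  then obtain b where b: "0 < b" "\<And>u. 0 < u \<Longrightarrow> u < b \<Longrightarrow> a / 2 < (1 - H u) / u powr \<theta>"
    by (auto simp: eventually_at_right_field)
  \<comment> \<open>Below 1 one has u \<le> u^\<theta> because \<theta> \<le> 1, so a linear lower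
    bound holds for every admissible \<theta>.\<close>
  define \<delta> where "\<delta> = min (b / 2) 1"
  have \<delta>: "0 < \<delta>" "\<delta> \<le> 1" "\<delta> < b" using b(1) by (auto simp: \<delta>_def)
  have near: "a / 2 * u \<le> 1 - H u" if "0 < u" "u \<le> \<delta>" for u
  proof -
    have "a / 2 * u powr 1 \<le> a / 2 * u powr \<theta>"
      using that \<delta> a \<theta> by (intro mult_left_mono powr_mono') auto
    also have "\<dots> \<le> 1 - H u"
      using b(2)[of u] that \<delta> by (simp add: field_simps)
    finally show ?thesis using that by simp
  qed
  \<comment> \<open>The maximum with 1/2 keeps \<gamma> positive, since it is divided by
    below.\<close>
  define \<gamma> where "\<gamma> = max (H \<delta>) (1 / 2)"
  have "0 < a / 2 * \<delta>" using a \<delta> by simp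
  then have \<gamma>: "0 < \<gamma>" "\<gamma> < 1" using near[of \<delta>] \<delta> by (auto simp: \<gamma>_def)
  obtain B1 where B1: "0 \<le> B1" "\<And>s. s \<ge> 1 \<Longrightarrow> exp (- (a / 2) * s) \<le> B1 * s powr (- q)"
    using powr_mult_exp_bounded[of "a / 2" q] a by auto
  obtain B2 where B2: "\<And>n. real n powr q * \<gamma> ^ n \<le> B2"
    using bounded_powr_mult_power[OF \<gamma>] by auto
  have "0 \<le> real 0 powr q * \<gamma> ^ 0" by simp
  with B2[of 0] have B2_nonneg: "0 \<le> B2" by linarith
  have B: "0 \<le> B" using tail[of 1] zero_le_power[OF H01(1), of 1 n0] by simp
  define k where "k = nat \<lceil>q / \<beta>\<rceil>"
  have k: "q \<le> \<beta> * real k"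
    using \<beta> of_nat_ceiling[of "q / \<beta>"] by (simp add: k_def field_simps)
  \<comment> \<open>This leaves room for the \<open>k\<close> blocks and makes \<open>N\<close>
    positive. The surplus exponent \<open>e\<close> is absorbed by x > \<delta>.\<close>
  define K where "K = Suc (n0 * k)"
  define e where "e = \<beta> * real k - q"
  define D2 where "D2 = B2 * (B ^ k * \<delta> powr (- e) / \<gamma> ^ (n0 * k))"
  have D2: "0 \<le> D2" unfolding D2_def using B2_nonneg B \<gamma> by simp
  have "H (s / real N) ^ N \<le> (B1 + D2) * s powr (- q)" if N: "K \<le> N" and s: "1 \<le> s" for N s
  proof -
    define x where "x = s / real N"
    have Npos: "0 < real N" using N by (simp add: K_def)
    have x: "0 < x" using s Npos by (simp add: x_def)
    consider "x \<le> \<delta>" | "\<delta> < x" by linarith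
    then have "H x ^ N \<le> B1 * s powr (- q) \<or> H x ^ N \<le> D2 * s powr (- q)"
    proof cases
      case 1
      have "H x ^ N = (1 - (1 - H x)) ^ N" by simp
      also have "\<dots> \<le> exp (- (real N * (1 - H x)))"
        by (rule one_minus_pow_le_exp) (use H01 in auto)
      also have "\<dots> \<le> exp (- (real N * (a / 2 * x)))"
        using near[OF x 1] Npos by simp
      also have "real N * (a / 2 * x) = a / 2 * s" using Npos by (simp add: x_def)
      finally show ?thesis using B1(2)[OF s] by simp
    next
      case 2
      have "H x ^ N = H x ^ (N - n0 * k) * (H x ^ n0) ^ k"
        using N by (simp add: power_mult[symmetric] power_add[symmetric] K_def)
      also have "\<dots> \<le> \<gamma> ^ (N - n0 * k) * (B * x powr (- \<beta>)) ^ k"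
        using anti[of \<delta> x] 2 \<delta> H01 \<gamma> tail[OF x]
        by (intro mult_mono power_mono) (auto simp: \<gamma>_def)
      also have "\<gamma> ^ (N - n0 * k) = \<gamma> ^ N / \<gamma> ^ (n0 * k)"
        using N \<gamma> by (simp add: K_def power_diff)
      also have "(B * x powr (- \<beta>)) ^ k = B ^ k * (x powr (- q) * x powr (- e))"
        using x by (simp add: power_mult_distrib powr_power powr_add[symmetric] e_def mult.commute)
      also have "\<gamma> ^ N / \<gamma> ^ (n0 * k) * (B ^ k * (x powr (- q) * x powr (- e)))
          \<le> \<gamma> ^ N / \<gamma> ^ (n0 * k) * (B ^ k * (x powr (- q) * \<delta> powr (- e)))"
        using 2 \<delta> k \<gamma> B by (intro mult_left_mono powr_mono2') (auto simp: e_def)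
      also have "x powr (- q) = s powr (- q) * real N powr q"
        using s Npos by (simp add: x_def powr_divide powr_minus divide_simps)
      also have "\<gamma> ^ N / \<gamma> ^ (n0 * k) * (B ^ k * (s powr (- q) * real N powr q * \<delta> powr (- e)))
         = (real N powr q * \<gamma> ^ N) * ((B ^ k * \<delta> powr (- e) / \<gamma> ^ (n0 * k)) * s powr (- q))"
        by simp
      also have "\<dots> \<le> B2 * ((B ^ k * \<delta> powr (- e) / \<gamma> ^ (n0 * k)) * s powr (- q))"
        using B \<gamma> by (intro mult_right_mono B2) auto
      finally show ?thesis by (simp add: D2_def mult.assoc)
    qed
    then show ?thesis
      using B1(1) D2 by (auto simp: x_def ring_distribs intro: order_trans add_increasing add_increasing2)
  qed
  then show ?thesis using B1(1) D2 by (intro exI[of _ K] exI[of _ "B1 + D2"]) auto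
qed

text \<open>After u = s/N the integrands converge pointwise and have an integrable majorant. If
  \<theta> < 1 then N (1 - H (s/N)) tends to infinity, so the limit integrand is 0.\<close>

lemma moment_asymptotics:
  fixes H :: "real \<Rightarrow> real" and p a \<theta> B \<beta> :: real and n0 :: nat
  assumes H[measurable]: "H \<in> borel_measurable borel"
    and H01: "\<And>u. 0 \<le> H u" "\<And>u. H u \<le> 1"
    and anti: "\<And>u v. 0 < u \<Longrightarrow> u \<le> v \<Longrightarrow> H v \<le> H u"
    and lim: "((\<lambda>u. (1 - H u) / u powr \<theta>) \<longlongrightarrow> a) (at_right 0)"
    and a: "0 < a" and \<theta>: "\<theta> \<le> 1" and p: "0 < p"
    and tail: "\<And>u. 0 < u \<Longrightarrow> H u ^ n0 \<le> B * u powr (- \<beta>)" "0 < \<beta>"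
  defines "f \<equiv> \<lambda>N u. indicator {0<..} u * (p * u powr (p - 1) * H u ^ N)"
  shows moment_integrable: "\<forall>\<^sub>F N in sequentially. integrable lborel (f N)"
    and moment_limit: "(\<lambda>N. real N powr p * (\<integral>u. f N u \<partial>lborel))
      \<longlonglongrightarrow> (if \<theta> = 1 then Gamma (1 + p) * (1 / a) powr p else 0)"
proof -
  obtain K0 D where D: "0 \<le> D"
    and K0: "\<And>N s. N \<ge> K0 \<Longrightarrow> s \<ge> 1 \<Longrightarrow> H (s / real N) ^ N \<le> D * s powr (- (p + 1))"
    using power_tail_bound[OF H01 anti lim a \<theta> tail, of "p + 1"] by blast
  define K where "K = Suc K0"
  define g where "g = (\<lambda>N s. indicator {0<..} s * (p * s powr (p - 1) * H (s / real N) ^ N))"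
  define w where "w = (\<lambda>s. indicator {0<..} s * (p * s powr (p - 1) * (if s \<le> 1 then 1 else D * s powr (- (p + 1)))))"
  define l where "l = (\<lambda>s. indicator {0<..} s * (p * s powr (p - 1) * (if \<theta> = 1 then exp (- (a * s)) else 0)))"
  \<comment> \<open>The weight u^(p - 1) yields N^(1 - p); with the Jacobian 1/N this makes up the
    scale N^(-p).\<close>
  have fg: "f N (0 + 1 / real N * s) = real N powr (1 - p) * g N s" if "N \<ge> K" for N s
    using that p by (auto simp: f_def g_def K_def indicator_def powr_divide powr_diff field_simps zero_less_divide_iff)
  have lim_g: "(\<lambda>N. g N s) \<longlonglongrightarrow> l s" for s
  proof (cases "s > 0")
    case s: True
    define y where "y = (\<lambda>n. 1 - H (s / real n))"
    have y: "0 \<le> y n" "y n \<le> 1" for n using H01 by (auto simp: y_def)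
    have "filterlim (\<lambda>n. s / real n) (at_right 0) sequentially"
      using s by real_asymp
    from filterlim_compose[OF lim this]
    have h: "(\<lambda>n. y n / (s / real n) powr \<theta>) \<longlonglongrightarrow> a" by (simp add: y_def)
    have eq: "\<forall>\<^sub>F n in sequentially. y n / (s / real n) powr \<theta> * (s powr \<theta> * real n powr (1 - \<theta>)) = real n * y n"
      using eventually_gt_at_top[of 0]
      by eventually_elim (use s in \<open>simp add: powr_divide powr_diff field_simps\<close>)
    have "(\<lambda>n. (1 - y n) ^ n) \<longlonglongrightarrow> (if \<theta> = 1 then exp (- (a * s)) else 0)"
    proof (cases "\<theta> = 1")
      case True
      have "(\<lambda>n. y n / (s / real n) powr \<theta> * s) \<longlonglongrightarrow> a * s"
        by (intro tendsto_mult h tendsto_const)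
      moreover have "\<forall>\<^sub>F n in sequentially. y n / (s / real n) powr \<theta> * s = real n * y n"
        using eq eventually_gt_at_top[of 0] by eventually_elim (use True s in simp)
      ultimately have "(\<lambda>n. real n * y n) \<longlonglongrightarrow> a * s"
        using Lim_transform_eventually by fast
      from tendsto_one_minus_pow[OF y(1) this] True show ?thesis by simp
    next
      case False
      then have "filterlim (\<lambda>n. s powr \<theta> * real n powr (1 - \<theta>)) at_top sequentially"
        using s \<theta> by real_asymp
      from filterlim_tendsto_pos_mult_at_top[OF h a this]
      have "filterlim (\<lambda>n. real n * y n) at_top sequentially"
        using filterlim_cong[OF refl refl eq] by simp
      then have "(\<lambda>n. exp (- (real n * y n))) \<longlonglongrightarrow> 0"
        by (intro filterlim_compose[OF exp_at_bot]) (simp add: filterlim_uminus_at_bot)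
      then have "(\<lambda>n. (1 - y n) ^ n) \<longlonglongrightarrow> 0"
        by (rule tendsto_sandwich[OF _ _ tendsto_const, rotated 2])
           (use y in \<open>auto intro!: always_eventually one_minus_pow_le_exp\<close>)
      with False show ?thesis by simp
    qed
    then have "(\<lambda>n. p * s powr (p - 1) * H (s / real n) ^ n)
        \<longlonglongrightarrow> p * s powr (p - 1) * (if \<theta> = 1 then exp (- (a * s)) else 0)"
      by (intro tendsto_mult tendsto_const) (simp add: y_def)
    then show ?thesis
      using s by (simp add: g_def l_def)
  qed (simp add: g_def l_def)
  \<comment> \<open>The majorant holds only from \<open>K\<close> on, whereas dominated convergence
    asks for it at every index; hence the shifted sequence.\<close>
  have bound: "norm (g (N + K) s) \<le> w s" for N s
  proof -
    have "H (s / real (N + K)) ^ (N + K) \<le> 1"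
      using H01 by (intro power_le_one) auto
    moreover have "0 \<le> H (s / real (N + K)) ^ (N + K)" using H01 by simp
    moreover have "H (s / real (N + K)) ^ (N + K) \<le> D * s powr (- (p + 1))" if "\<not> s \<le> 1"
      using K0[of "N + K" s] that by (simp add: K_def)
    ultimately show ?thesis
      using p by (auto simp: g_def w_def indicator_def abs_mult intro!: mult_left_mono)
  qed
  have w: "integrable lborel w"
    unfolding w_def using p D by (rule integrable_powr_dominator)
  have gm: "g N \<in> borel_measurable lborel" for N unfolding g_def by measurable
  have lm: "l \<in> borel_measurable lborel" unfolding l_def by measurable
  have int_g: "integrable lborel (g (N + K))" for N
    by (rule Bochner_Integration.integrable_bound[OF w gm]) (use bound in \<open>auto intro!: AE_I2 order_trans[OF _ abs_ge_self]\<close>)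
  have fint: "integrable lborel (f N)" "real N powr p * (\<integral>u. f N u \<partial>lborel) = (\<integral>u. g N u \<partial>lborel)"
    if N: "N \<ge> K" for N
  proof -
    have Npos: "0 < real N" using N by (simp add: K_def)
    have "integrable lborel (g N)" using int_g[of "N - K"] N by simp
    then have "integrable lborel (\<lambda>s. f N (0 + 1 / real N * s))"
      unfolding fg[OF N] by simp
    then show "integrable lborel (f N)"
      using lborel_integrable_real_affine_iff[of "1 / real N" "f N" 0] Npos by simp
    have "(\<integral>u. f N u \<partial>lborel) = (1 / real N) * (real N powr (1 - p) * (\<integral>u. g N u \<partial>lborel))"
      using lborel_integral_real_affine[of "1 / real N" "f N" 0] Npos unfolding fg[OF N] by simp
    then show "real N powr p * (\<integral>u. f N u \<partial>lborel) = (\<integral>u. g N u \<partial>lborel)"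
      using Npos by (simp add: powr_diff)
  qed
  show "\<forall>\<^sub>F N in sequentially. integrable lborel (f N)"
    using fint(1) by (auto simp: eventually_at_top_linorder)
  have "(\<lambda>N. \<integral>u. g (N + K) u \<partial>lborel) \<longlonglongrightarrow> (\<integral>u. l u \<partial>lborel)"
  proof (rule integral_dominated_convergence[OF lm gm w])
    show "AE s in lborel. (\<lambda>N. g (N + K) s) \<longlonglongrightarrow> l s"
      using lim_g LIMSEQ_ignore_initial_segment by (intro AE_I2) blast
  qed (use bound in auto)
  then have lim_int: "(\<lambda>N. \<integral>u. g N u \<partial>lborel) \<longlonglongrightarrow> (\<integral>u. l u \<partial>lborel)"
    by (rule LIMSEQ_offset)
  have int_l: "(\<integral>u. l u \<partial>lborel) = (if \<theta> = 1 then Gamma (1 + p) * (1 / a) powr p else 0)"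
    unfolding l_def using has_bochner_integral_powr_exp[OF a p] by (auto simp: has_bochner_integral_iff)
  have "\<forall>\<^sub>F N in sequentially. (\<integral>u. g N u \<partial>lborel) = real N powr p * (\<integral>u. f N u \<partial>lborel)"
    using eventually_ge_at_top[of K] by eventually_elim (simp add: fint(2))
  from Lim_transform_eventually[OF lim_int this] show "(\<lambda>N. real N powr p * (\<integral>u. f N u \<partial>lborel))
      \<longlonglongrightarrow> (if \<theta> = 1 then Gamma (1 + p) * (1 / a) powr p else 0)"
    unfolding int_l .
qed

section \<open>Cover times\<close>

lemma nn_integral_powr_Icc:
  fixes c p :: real
  assumes "0 \<le> c" "0 < p"
  shows "(\<integral>\<^sup>+u. ennreal (indicator {0..c} u * (p * u powr (p - 1))) \<partial>lborel) = ennreal (c powr p)"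
proof -
  have "((\<lambda>u. p * u powr (p - 1)) has_integral p * (c powr (p - 1 + 1) / (p - 1 + 1))) {0..c}"
    using assms by (intro has_integral_mult_right has_integral_powr_from_0) auto
  then have "((\<lambda>u. p * u powr (p - 1)) has_integral c powr p) {0..c}"
    using assms by simp
  from nn_integral_has_integral_lebesgue[OF _ this] show ?thesis
    using assms by simp
qed

text \<open>Integrating in \<open>u = t^d\<close> instead of \<open>t\<close> makes the rescaling by the number of searchers linear.\<close>

lemma enn_powr_layer_cake:
  fixes \<sigma> :: ennreal and d :: nat and m p :: real
  assumes d: "0 < d" and m: "0 < m" and p: "p = m / real d"
  shows "enn_powr \<sigma> m = (\<integral>\<^sup>+u. ennreal (indicator {0<..} u * (p * u powr (p - 1)))
    * indicator {u. ennreal (u powr (1 / real d)) < \<sigma>} u \<partial>lborel)"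
proof (cases "\<sigma> = \<top>")
  case True
  let ?I = "\<integral>\<^sup>+u. ennreal (indicator {0<..} u * (p * u powr (p - 1))) \<partial>lborel"
  have p0: "0 < p" using d m p by simp
  \<comment> \<open>For an infinite value the indicator is constantly 1, so the total mass of the
    weight must be shown to be infinite; bounded intervals already give arbitrarily large
    mass.\<close>
  have ge: "ennreal y \<le> ?I" if "0 < y" for y
  proof -
    have "ennreal y = ennreal ((y powr (1 / p)) powr p)"
      using that p0 by (simp add: powr_powr)
    also have "\<dots> = (\<integral>\<^sup>+u. ennreal (indicator {0..y powr (1 / p)} u * (p * u powr (p - 1))) \<partial>lborel)"
      using p0 by (intro nn_integral_powr_Icc[symmetric]) auto
    also have "\<dots> \<le> ?I"
      using p0 by (intro nn_integral_mono) (auto simp: indicator_def)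
    finally show ?thesis .
  qed
  have "?I = \<top>"
  proof (rule ccontr)
    assume "?I \<noteq> \<top>"
    then obtain r where "0 \<le> r" "?I = ennreal r" by (cases ?I) auto
    with ge[of "r + 1"] show False by simp
  qed
  then show ?thesis using True by (simp add: enn_powr_def)
next
  case False
  then obtain r where r: "0 \<le> r" "\<sigma> = ennreal r" by (cases \<sigma>) auto
  have p0: "0 < p" using d m p by simp
  have iff: "u powr (1 / real d) < r \<longleftrightarrow> u < r ^ d" if "0 < u" for u
  proof -
    have "u = (u powr (1 / real d)) ^ d"
      using that d by (simp add: powr_realpow[symmetric] powr_powr)
    then show ?thesis
      using power_strict_mono[of "u powr (1 / real d)" r d] power_mono[of r "u powr (1 / real d)" d] r d
      by (metis not_le powr_ge_zero)
  qed
  have "ennreal (r powr m) = ennreal ((r ^ d) powr p)"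
  proof (cases "r = 0")
    case False
    then show ?thesis using r d p by (simp add: powr_realpow[symmetric] powr_powr)
  qed (use d in simp)
  also have "\<dots> = (\<integral>\<^sup>+u. ennreal (indicator {0..r ^ d} u * (p * u powr (p - 1))) \<partial>lborel)"
    using p0 r by (intro nn_integral_powr_Icc[symmetric]) auto
  also have "\<dots> = (\<integral>\<^sup>+u. ennreal (indicator {0<..} u * (p * u powr (p - 1)))
      * indicator {u. ennreal (u powr (1 / real d)) < \<sigma>} u \<partial>lborel)"
  proof (rule nn_integral_cong_AE)
    \<comment> \<open>The closed interval and the strict inequality can disagree only at this
      point.\<close>
    have "AE u in lborel. u \<noteq> r ^ d" by (rule AE_lborel_singleton)
    then show "AE u in lborel. ennreal (indicator {0..r ^ d} u * (p * u powr (p - 1)))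
      = ennreal (indicator {0<..} u * (p * u powr (p - 1))) * indicator {u. ennreal (u powr (1 / real d)) < \<sigma>} u"
    proof eventually_elim
      case (elim u)
      then show ?case
        using iff[of u] r by (cases "u > 0") (auto simp: indicator_def ennreal_less_iff)
    qed
  qed
  finally show ?thesis using r by (simp add: enn_powr_def)
qed

locale searchers = bounded_generator_init Q C \<rho> + prob_space M
  for Q :: "'i::countable \<Rightarrow> 'i \<Rightarrow> real" and C \<rho> and M :: "'a measure" +
  fixes X :: "nat \<Rightarrow> real \<Rightarrow> 'a \<Rightarrow> 'i"
  assumes X_ctmc: "\<And>n. is_ctmc M Q \<rho> (X n)"
    and X_indep: "indep_vars (\<lambda>_. Pi\<^sub>M UNIV (\<lambda>_::real. count_space (UNIV::'i set)))
           (\<lambda>n \<omega>. (\<lambda>t. X n t \<omega>)) UNIV"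
begin

sublocale X: ctmc Q C \<rho> M "X n" for n
  by unfold_locales (rule X_ctmc)

text \<open>Searcher 0 acts as representative; \<open>prob_miss\<close> transfers the value to the
  others.\<close>

definition miss :: "'i set \<Rightarrow> real \<Rightarrow> real" where
  "miss J t = prob (space M - X.hit 0 J t)"

lemma prob_miss: "prob (space M - X.hit n J t) = miss J t"
proof -
  have "prob (X.hit n J t) = prob (X.hit 0 J t)"
    by (rule prob_hit_cong) unfold_locales
  then show ?thesis by (simp add: miss_def prob_compl)
qed

lemma miss_nonneg: "0 \<le> miss J t" and miss_le_1: "miss J t \<le> 1"
  by (simp_all add: miss_def)

lemma miss_antimono: "s \<le> t \<Longrightarrow> miss J t \<le> miss J s"
  unfolding miss_def using X.hit_mono[of s t 0 J] by (intro finite_measure_mono) auto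

lemma miss_subset:
  assumes "J \<subseteq> J'"
  shows "miss J' t \<le> miss J t"
proof -
  have "X.hit 0 J t \<subseteq> X.hit 0 J' t" using assms by (auto simp: X.hit_def)
  then show ?thesis unfolding miss_def by (intro finite_measure_mono) auto
qed

lemma miss_measurable[measurable]: "miss J \<in> borel_measurable borel"
proof -
  have "mono (\<lambda>t. - miss J t)" using miss_antimono by (auto simp: mono_def)
  then have "(\<lambda>t. - miss J t) \<in> borel_measurable borel" by (rule borel_measurable_mono)
  then show ?thesis by simp
qed

definition all_miss :: "nat \<Rightarrow> 'i set \<Rightarrow> real \<Rightarrow> 'a set" where
  "all_miss N J t = {\<omega>\<in>space M. \<forall>n<N. \<omega> \<notin> X.hit n J t}"

lemma all_miss_sets[measurable]: "all_miss N J t \<in> sets M"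
proof -
  have "all_miss N J t = space M - (\<Union>n\<in>{..<N}. X.hit n J t)" by (auto simp: all_miss_def)
  then show ?thesis by simp
qed

text \<open>Independence concerns trajectories as elements of the product space, so missing
  \<open>J\<close> must be the preimage of a product-measurable set. Only the countable dyadic
  description has that form; right-constancy identifies it with missing \<open>J\<close> in
  continuous time. \<open>N = 0\<close> is separate because the product rule is used for nonempty
  index sets.\<close>

lemma prob_all_miss:
  assumes t: "0 \<le> t"
  shows "prob (all_miss N J t) = miss J t ^ N"
proof (cases "N = 0")
  case True
  then show ?thesis by (simp add: all_miss_def prob_space)
next
  case False
  define P where "P = Pi\<^sub>M UNIV (\<lambda>_::real. count_space (UNIV::'i set))"
  have [measurable]: "(\<lambda>f. f s) \<in> measurable P (count_space UNIV)" for s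
    unfolding P_def by (rule measurable_component_singleton) simp
  define A where "A = {f \<in> space P. \<forall>k. \<forall>l\<le>2 ^ k. f (t * real l / 2 ^ k) \<notin> J}"
  have A: "A \<in> sets P" unfolding A_def by measurable
  have eq: "(\<lambda>\<omega> t. X n t \<omega>) -` A \<inter> space M = space M - X.hit n J t" for n
    unfolding X.hit_eq_UN_grid_hit[OF t]
    by (auto simp: A_def P_def space_PiM X.grid_hit_def)
  have "prob (\<Inter>n\<in>{..<N}. (\<lambda>\<omega> t. X n t \<omega>) -` A \<inter> space M)
      = (\<Prod>n\<in>{..<N}. prob ((\<lambda>\<omega> t. X n t \<omega>) -` A \<inter> space M))"
    using False A by (intro indep_varsD[OF X_indep]) (auto simp: P_def lessThan_empty_iff)
  moreover have "(\<Inter>n\<in>{..<N}. space M - X.hit n J t) = all_miss N J t"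
    using False by (auto simp: all_miss_def)
  ultimately show ?thesis unfolding eq prob_miss by simp
qed

section \<open>Law and moments of the cover time\<close>

lemma visited_iff:
  "\<omega> \<in> space M \<Longrightarrow> j \<in> visited X N t \<omega> \<longleftrightarrow> (\<exists>n<N. \<omega> \<in> X.hit n {j} t)"
  by (auto simp: visited_def X.hit_def)

text \<open>The infimum is attained in the sense that matters: the finitely many searchers all stay
  put on a common interval to the right of \<open>t\<close>, so a target not visited by
  \<open>t\<close> remains unvisited until that interval ends.\<close>

lemma cover_time_le_iff:
  assumes \<omega>: "\<omega> \<in> space M" and t: "0 \<le> t"
  shows "cover_time X U N \<omega> \<le> ennreal t \<longleftrightarrow> U \<subseteq> visited X N t \<omega>"
proof
  assume U: "U \<subseteq> visited X N t \<omega>"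
  show "cover_time X U N \<omega> \<le> ennreal t"
  \<comment> \<open>The infimum ranges over positive times only, so \<open>t = 0\<close> has to be
    approached through \<open>t + e\<close>.\<close>
  proof (rule ennreal_le_epsilon)
    fix e :: real assume e: "0 < e"
    have "visited X N t \<omega> \<subseteq> visited X N (t + e) \<omega>" using e by (force simp: visited_def)
    then have "U \<subseteq> visited X N (t + e) \<omega>" "0 < t + e" using U e t by auto
    then have "cover_time X U N \<omega> \<le> ennreal (t + e)"
      unfolding cover_time_def by (intro Inf_lower) blast
    then show "cover_time X U N \<omega> \<le> ennreal t + ennreal e" using e t by simp
  qed
next
  assume le: "cover_time X U N \<omega> \<le> ennreal t"
  show "U \<subseteq> visited X N t \<omega>"
  proof (rule ccontr)
    assume "\<not> U \<subseteq> visited X N t \<omega>"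
    then obtain j where j: "j \<in> U" "j \<notin> visited X N t \<omega>" by auto
    have "\<forall>\<^sub>F s in at_right t. X n s \<omega> = X n t \<omega>" for n
    proof -
      obtain \<epsilon> where \<epsilon>: "0 < \<epsilon>" "\<And>s. t \<le> s \<Longrightarrow> s < t + \<epsilon> \<Longrightarrow> X n s \<omega> = X n t \<omega>"
        using X.Y_right_const[OF \<omega> t, of n] by blast
      show ?thesis
        unfolding eventually_at_right_field
        by (intro exI[of _ "t + \<epsilon>"] conjI allI impI \<epsilon>(2)) (use \<epsilon>(1) in auto)
    qed
    then have "\<forall>\<^sub>F s in at_right t. \<forall>n\<in>{..<N}. X n s \<omega> = X n t \<omega>"
      by (intro eventually_ball_finite) auto
    then obtain b where b: "t < b" "\<And>s n. t < s \<Longrightarrow> s < b \<Longrightarrow> n < N \<Longrightarrow> X n s \<omega> = X n t \<omega>"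
      unfolding eventually_at_right_field by blast
    have "ennreal b \<le> cover_time X U N \<omega>"
      unfolding cover_time_def
    proof (rule Inf_greatest, clarify)
      fix t' assume t': "0 < t'" "U \<subseteq> visited X N t' \<omega>"
      show "ennreal b \<le> ennreal t'"
      proof (rule ccontr)
        assume "\<not> ennreal b \<le> ennreal t'"
        then have "t' < b" using t' by (auto simp: not_le ennreal_less_iff)
        obtain n s where s: "n < N" "0 \<le> s" "s \<le> t'" "X n s \<omega> = j"
          using t' j(1) unfolding visited_def by blast
        \<comment> \<open>A visit between \<open>t\<close> and \<open>b\<close> is moved back to
          \<open>t\<close>, where the searcher is already in the same state.\<close>
        have "X n (min s t) \<omega> = j" using b(2)[of s n] s \<open>t' < b\<close> by (cases "s \<le> t") auto
        then have "j \<in> visited X N t \<omega>" using s(1,2) t unfolding visited_def by force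
        with j show False by simp
      qed
    qed
    also note le
    finally show False using b(1) t by (simp add: not_le[symmetric])
  qed
qed

lemma not_covered_eq:
  assumes "0 \<le> t"
  shows "{\<omega>\<in>space M. ennreal t < cover_time X U N \<omega>} = (\<Union>j\<in>U. all_miss N {j} t)"
proof -
  have "ennreal t < cover_time X U N \<omega> \<longleftrightarrow> (\<exists>j\<in>U. \<forall>n<N. \<omega> \<notin> X.hit n {j} t)" if "\<omega> \<in> space M" for \<omega>
    using cover_time_le_iff[OF that assms, of U N] visited_iff[OF that, of _ N t] by (auto simp: not_le[symmetric])
  then show ?thesis by (auto simp: all_miss_def)
qed

lemma cover_time_measurable[measurable]:
  assumes "finite U"
  shows "cover_time X U N \<in> borel_measurable M"
proof (rule borel_measurableI_le)
  fix y :: ennreal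
  show "{\<omega>\<in>space M. cover_time X U N \<omega> \<le> y} \<in> sets M"
  proof (cases y)
    case (real t)
    have "{\<omega>\<in>space M. cover_time X U N \<omega> \<le> y} = space M - {\<omega>\<in>space M. ennreal t < cover_time X U N \<omega>}"
      using real by (auto simp: not_le[symmetric])
    also have "\<dots> \<in> sets M"
      unfolding not_covered_eq[OF real(1)] using assms by auto
    finally show ?thesis .
  qed simp
qed

text \<open>Intersections collapse: missing every state of a nonempty \<open>J\<close> is missing
  \<open>J\<close>, so independence turns each term into an exact N-th power.\<close>

lemma prob_not_covered:
  assumes t: "0 \<le> t" and U: "finite U"
  shows "prob {\<omega>\<in>space M. ennreal t < cover_time X U N \<omega>}
    = (\<Sum>J | J \<subseteq> U \<and> J \<noteq> {}. (- 1) ^ (card J + 1) * miss J t ^ N)"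
proof -
  interpret Incl_Excl "\<lambda>S. S \<in> sets M" prob
    by unfold_locales (auto simp: finite_measure_Union disjnt_def)
  have "prob (\<Union>j\<in>U. all_miss N {j} t)
      = (\<Sum>J | J \<subseteq> U \<and> J \<noteq> {}. (- 1) ^ (card J + 1) * prob (\<Inter>j\<in>J. all_miss N {j} t))"
    using U by (intro restricted_indexed) auto
  also have "\<dots> = (\<Sum>J | J \<subseteq> U \<and> J \<noteq> {}. (- 1) ^ (card J + 1) * miss J t ^ N)"
  proof (intro sum.cong refl)
    fix J assume "J \<in> {J. J \<subseteq> U \<and> J \<noteq> {}}"
    then have "(\<Inter>j\<in>J. all_miss N {j} t) = all_miss N J t"
      by (auto simp: all_miss_def X.hit_def)
    then show "(- 1) ^ (card J + 1) * prob (\<Inter>j\<in>J. all_miss N {j} t) = (- 1) ^ (card J + 1) * miss J t ^ N"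
      by (simp add: prob_all_miss[OF t])
  qed
  finally show ?thesis unfolding not_covered_eq[OF t] .
qed

lemma cover_moment_eq:
  assumes d: "0 < d" and m: "0 < m" and p: "p = m / real d" and U: "finite U"
  shows "(\<integral>\<^sup>+\<omega>. enn_powr (cover_time X U N \<omega>) m \<partial>M) =
    (\<integral>\<^sup>+u. ennreal (indicator {0<..} u * (p * u powr (p - 1)) *
       prob {\<omega>\<in>space M. ennreal (u powr (1 / real d)) < cover_time X U N \<omega>}) \<partial>lborel)"
proof -
  interpret pair_sigma_finite M lborel ..
  have p0: "0 \<le> p" using d m p by simp
  have [measurable]: "cover_time X U N \<in> borel_measurable M" by (rule cover_time_measurable[OF U])
  let ?g = "\<lambda>u. ennreal (indicator {0<..} u * (p * u powr (p - 1)))"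
  have "(\<integral>\<^sup>+\<omega>. enn_powr (cover_time X U N \<omega>) m \<partial>M)
      = (\<integral>\<^sup>+\<omega>. \<integral>\<^sup>+u. ?g u * indicator {x. ennreal (snd x powr (1 / real d)) < cover_time X U N (fst x)} (\<omega>, u) \<partial>lborel \<partial>M)"
    by (simp add: enn_powr_layer_cake[OF d m p] indicator_def)
  also have "\<dots> = (\<integral>\<^sup>+u. \<integral>\<^sup>+\<omega>. ?g u * indicator {x. ennreal (snd x powr (1 / real d)) < cover_time X U N (fst x)} (\<omega>, u) \<partial>M \<partial>lborel)"
    by (rule Fubini'[symmetric]) (simp add: case_prod_beta', measurable)
  also have "\<dots> = (\<integral>\<^sup>+u. ennreal (indicator {0<..} u * (p * u powr (p - 1)) *
       prob {\<omega>\<in>space M. ennreal (u powr (1 / real d)) < cover_time X U N \<omega>}) \<partial>lborel)"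
  proof (rule nn_integral_cong)
    fix u :: real
    let ?B = "{\<omega>\<in>space M. ennreal (u powr (1 / real d)) < cover_time X U N \<omega>}"
    have "(\<integral>\<^sup>+\<omega>. ?g u * indicator {x. ennreal (snd x powr (1 / real d)) < cover_time X U N (fst x)} (\<omega>, u) \<partial>M)
        = (\<integral>\<^sup>+\<omega>. ?g u * indicator ?B \<omega> \<partial>M)"
      by (intro nn_integral_cong) (auto simp: indicator_def)
    also have "\<dots> = ?g u * emeasure M ?B"
      by (rule nn_integral_cmult_indicator) measurable
    also have "\<dots> = ennreal (indicator {0<..} u * (p * u powr (p - 1)) * prob ?B)"
      using p0 by (subst ennreal_mult) (auto simp: emeasure_eq_measure)
    finally show "(\<integral>\<^sup>+\<omega>. ?g u * indicator {x. ennreal (snd x powr (1 / real d)) < cover_time X U N (fst x)} (\<omega>, u) \<partial>M)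
        = ennreal (indicator {0<..} u * (p * u powr (p - 1)) * prob ?B)" .
  qed
  finally show ?thesis .
qed

text \<open>Markov's inequality: on \<open>all_miss N {j} t\<close> every one of the first
  \<open>N\<close> hitting times is at least \<open>t\<close>, hence so is their minimum.\<close>

lemma miss_tail:
  assumes "(\<integral>\<^sup>+\<omega>. fpt X N j \<omega> \<partial>M) < \<top>"
  obtains B where "\<And>t. 0 < t \<Longrightarrow> t * miss {j} t ^ N \<le> B"
proof -
  obtain B where B: "0 \<le> B" "(\<integral>\<^sup>+\<omega>. fpt X N j \<omega> \<partial>M) = ennreal B"
    using assms by (cases "\<integral>\<^sup>+\<omega>. fpt X N j \<omega> \<partial>M") auto
  have "t * miss {j} t ^ N \<le> B" if t: "0 < t" for t
  proof -
    have "ennreal (t * miss {j} t ^ N) = ennreal t * emeasure M (all_miss N {j} t)"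
      using t prob_all_miss[of t N "{j}"] by (simp add: emeasure_eq_measure ennreal_mult miss_nonneg)
    also have "\<dots> = (\<integral>\<^sup>+\<omega>. ennreal t * indicator (all_miss N {j} t) \<omega> \<partial>M)"
      by (rule nn_integral_cmult_indicator[symmetric]) measurable
    also have "\<dots> \<le> (\<integral>\<^sup>+\<omega>. fpt X N j \<omega> \<partial>M)"
    proof (rule nn_integral_mono)
      fix \<omega> assume "\<omega> \<in> space M"
      have "ennreal t \<le> fpt X N j \<omega>" if \<omega>: "\<omega> \<in> all_miss N {j} t"
        unfolding fpt_def hit_time_def
      proof (rule Inf_greatest, clarify, rule Inf_greatest, clarify)
        fix n s assume s: "n < N" "0 < s" "j = X n s \<omega>"
        have "\<omega> \<notin> X.hit n {j} t" "\<omega> \<in> space M" using \<omega> s(1) by (auto simp: all_miss_def)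
        then have "\<not> s \<le> t" using s(2,3) less_imp_le[OF s(2)] unfolding X.hit_def by blast
        then show "ennreal t \<le> ennreal s" by (simp add: ennreal_leI)
      qed
      then show "ennreal t * indicator (all_miss N {j} t) \<omega> \<le> fpt X N j \<omega>"
        by (auto simp: indicator_def)
    qed
    finally show ?thesis using B by simp
  qed
  then show ?thesis by (rule that)
qed

text \<open>An unreachable state is missed with probability 1 at all times, against the decay of
  order 1/t. This makes \<open>dd\<close> a genuine distance.\<close>

lemma depth_finite:
  assumes "(\<integral>\<^sup>+\<omega>. fpt X N j \<omega> \<partial>M) < \<top>"
  shows "depth j \<noteq> \<infinity>"
proof
  assume inf: "depth j = \<infinity>"
  obtain B where B: "\<And>t. 0 < t \<Longrightarrow> t * miss {j} t ^ N \<le> B" using miss_tail[OF assms] by blast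
  have "miss {j} t = 1" for t
    using X.prob_hit_unreachable[OF inf, of 0 t] by (simp add: miss_def prob_compl)
  then have "t \<le> B" if "0 < t" for t using B[OF that] by simp
  from this[of "\<bar>B\<bar> + 1"] show False by linarith
qed

text \<open>The distance from the support to \<open>J\<close>, when finite, as a natural number so
  that it can serve as an exponent.\<close>

definition set_depth :: "'i set \<Rightarrow> nat" where
  "set_depth J = (LEAST k. \<exists>j\<in>J. depth j = enat k)"

lemma set_depth:
  assumes J: "J \<noteq> {}" "\<And>j. j \<in> J \<Longrightarrow> depth j \<noteq> \<infinity>"
  shows set_depth_attained: "\<exists>j\<in>J. depth j = enat (set_depth J)"
    and set_depth_le: "j \<in> J \<Longrightarrow> enat (set_depth J) \<le> depth j"
proof -
  obtain i where i: "i \<in> J" using J by auto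
  then obtain k where "depth i = enat k" using J(2) by fastforce
  then have "\<exists>k. \<exists>j\<in>J. depth j = enat k" using i by blast
  from LeastI_ex[OF this] show "\<exists>j\<in>J. depth j = enat (set_depth J)"
    unfolding set_depth_def .
  show "enat (set_depth J) \<le> depth j" if j: "j \<in> J"
  proof -
    obtain k where k: "depth j = enat k" using J(2)[OF j] by fastforce
    then have "\<exists>j\<in>J. depth j = enat k" using j by blast
    then have "set_depth J \<le> k" unfolding set_depth_def by (rule Least_le)
    then show ?thesis using k by simp
  qed
qed

text \<open>Substituting t = u^(1/d), a hitting probability of order t^e becomes u^\<theta> with
  \<theta> = e/d, and the tail B/t gives the exponent 1/d. The case \<theta> = 1 occurs exactly when
  all of \<open>J\<close> is farthest.\<close>

lemma miss_moment:
  fixes d :: nat and p :: real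
  assumes J: "finite J" "J \<noteq> {}" and fpt: "\<forall>j\<in>J. \<exists>N\<ge>1. (\<integral>\<^sup>+\<omega>. fpt X N j \<omega> \<partial>M) < \<top>"
    and d: "0 < d" "\<And>j. j \<in> J \<Longrightarrow> depth j \<le> enat d" and p: "0 < p"
  defines "f \<equiv> \<lambda>N u. indicator {0<..} u * (p * u powr (p - 1) * miss J (u powr (1 / real d)) ^ N)"
  shows "\<forall>\<^sub>F N in sequentially. integrable lborel (f N)"
    and "(\<lambda>N. real N powr p * (\<integral>u. f N u \<partial>lborel)) \<longlonglongrightarrow>
      (if \<forall>j\<in>J. depth j = enat d then Gamma (1 + p) * (fact d / Lambda Q \<rho> J) powr p else 0)"
proof -
  define H where "H = (\<lambda>u. miss J (u powr (1 / real d)))"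
  have H[measurable]: "H \<in> borel_measurable borel" unfolding H_def by measurable
  have H01: "0 \<le> H u" "H u \<le> 1" for u by (auto simp: H_def miss_nonneg miss_le_1)
  have anti: "H v \<le> H u" if "0 < u" "u \<le> v" for u v
    unfolding H_def using that d by (intro miss_antimono powr_mono2) auto
  have fin: "depth j \<noteq> \<infinity>" if "j \<in> J" for j using fpt that depth_finite by blast
  define e where "e = set_depth J"
  have e1: "\<exists>j\<in>J. depth j = enat e" unfolding e_def using set_depth_attained[OF J(2) fin] by blast
  have e2: "enat e \<le> depth j" if "j \<in> J" for j unfolding e_def using set_depth_le[OF J(2) fin that] by blast
  have "enat e \<le> enat d" using e1 d(2) by force
  then have ed: "e \<le> d" by simp
  define \<theta> where "\<theta> = real e / real d"
  have \<theta>: "\<theta> \<le> 1" using ed d by (simp add: \<theta>_def)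
  define a where "a = (\<Sum>j\<in>J. deriv_mass e j) / fact e"
  have "0 < (\<Sum>j\<in>J. deriv_mass e j)"
  proof -
    obtain j where "j \<in> J" "depth j = enat e" using e1 by auto
    then show ?thesis
      using J(1) e2 by (intro sum_pos2[of J j]) (auto intro: deriv_mass_pos deriv_mass_nonneg)
  qed
  then have a: "0 < a" by (simp add: a_def)
  have "filterlim (\<lambda>u. u powr (1 / real d)) (at_right 0) (at_right 0)"
  proof -
    have "0 < 1 / real d" using d by simp
    then show ?thesis by real_asymp
  qed
  from filterlim_compose[OF X.prob_hit_asymptotics[OF J(1) e2, of 0] this]
  have "((\<lambda>u. prob (X.hit 0 J (u powr (1 / real d))) / (u powr (1 / real d)) ^ e) \<longlongrightarrow> a) (at_right 0)"
    by (simp add: a_def)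
  moreover have "\<forall>\<^sub>F u in at_right 0. prob (X.hit 0 J (u powr (1 / real d))) / (u powr (1 / real d)) ^ e
      = (1 - H u) / u powr \<theta>"
    using eventually_at_right_less[of 0]
  proof eventually_elim
    case (elim u)
    have "(u powr (1 / real d)) ^ e = u powr \<theta>"
      using elim by (simp add: powr_realpow[symmetric] powr_powr \<theta>_def)
    then show ?case by (simp add: H_def miss_def prob_compl)
  qed
  ultimately have lim: "((\<lambda>u. (1 - H u) / u powr \<theta>) \<longlongrightarrow> a) (at_right 0)"
    by (rule Lim_transform_eventually)
  \<comment> \<open>One target suffices for the tail, as missing \<open>J\<close> entails missing
    each of its states.\<close>
  obtain j where j: "j \<in> J" using J(2) by auto
  then obtain n0 where n0: "(\<integral>\<^sup>+\<omega>. fpt X n0 j \<omega> \<partial>M) < \<top>" using fpt by blast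
  obtain B where B: "\<And>t. 0 < t \<Longrightarrow> t * miss {j} t ^ n0 \<le> B" using miss_tail[OF n0] by blast
  have tail: "H u ^ n0 \<le> B * u powr (- (1 / real d))" if "0 < u" for u
  proof -
    define t where "t = u powr (1 / real d)"
    have t: "0 < t" using that by (simp add: t_def)
    have "H u ^ n0 \<le> miss {j} t ^ n0"
      unfolding H_def t_def using j by (intro power_mono miss_subset miss_nonneg) auto
    also have "\<dots> \<le> B / t" using B[OF t] t by (simp add: pos_le_divide_eq mult.commute)
    finally show ?thesis by (simp add: t_def powr_minus divide_inverse)
  qed
  have \<beta>: "0 < 1 / real d" using d by simp
  note asym = moment_integrable[OF H H01 anti lim a \<theta> p tail \<beta>] moment_limit[OF H H01 anti lim a \<theta> p tail \<beta>]
  show "\<forall>\<^sub>F N in sequentially. integrable lborel (f N)"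
    unfolding f_def using asym(1) by (simp add: H_def)
  have iff: "\<theta> = 1 \<longleftrightarrow> (\<forall>j\<in>J. depth j = enat d)"
  proof
    assume "\<theta> = 1"
    then have "e = d" using d by (simp add: \<theta>_def)
    then show "\<forall>j\<in>J. depth j = enat d" using e2 d(2) by (auto intro: antisym)
  next
    assume "\<forall>j\<in>J. depth j = enat d"
    then have "e = d" using e1 by auto
    then show "\<theta> = 1" using d by (simp add: \<theta>_def)
  qed
  have const: "1 / a = fact d / Lambda Q \<rho> J" if all: "\<forall>j\<in>J. depth j = enat d"
  proof -
    have "e = d" using all e1 by auto
    then show ?thesis using Lambda_eq_sum_deriv_mass[OF J, of d] all by (simp add: a_def)
  qed
  show "(\<lambda>N. real N powr p * (\<integral>u. f N u \<partial>lborel)) \<longlonglongrightarrow>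
      (if \<forall>j\<in>J. depth j = enat d then Gamma (1 + p) * (fact d / Lambda Q \<rho> J) powr p else 0)"
    unfolding f_def using asym(2) const by (simp add: H_def iff cong: if_cong)
qed

end

lemma sum_nonempty_subsets_by_card:
  fixes g :: "'a set \<Rightarrow> real"
  assumes "finite F"
  shows "(\<Sum>i=1..card F. (- 1) ^ (i - 1) * (\<Sum>J\<in>{J. J \<subseteq> F \<and> card J = i}. g J))
    = (\<Sum>J | J \<subseteq> F \<and> J \<noteq> {}. (- 1) ^ (card J + 1) * g J)"
proof -
  let ?S = "{J. J \<subseteq> F \<and> J \<noteq> {}}"
  have S: "finite ?S" using assms by simp
  have im: "card ` ?S \<subseteq> {1..card F}"
    using assms by (auto simp: card_mono Suc_le_eq card_gt_0_iff finite_subset)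
  have "(\<Sum>J\<in>?S. (- 1) ^ (card J + 1) * g J)
      = (\<Sum>i=1..card F. \<Sum>J | J \<in> ?S \<and> card J = i. (- 1) ^ (card J + 1) * g J)"
    by (rule sum.group[OF S _ im, symmetric]) simp
  also have "\<dots> = (\<Sum>i=1..card F. (- 1) ^ (i - 1) * (\<Sum>J\<in>{J. J \<subseteq> F \<and> card J = i}. g J))"
  proof (rule sum.cong[OF refl])
    fix i assume i: "i \<in> {1..card F}"
    then have "{J. J \<in> ?S \<and> card J = i} = {J. J \<subseteq> F \<and> card J = i}" by auto
    \<comment> \<open>Subtraction on naturals truncates, so the signs agree only from
      \<open>i = 1\<close> on; nonempty subsets guarantee this.\<close>
    moreover have "(- 1 :: real) ^ (i + 1) = (- 1) ^ (i - 1)"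
      using i by (cases i) auto
    ultimately show "(\<Sum>J | J \<in> ?S \<and> card J = i. (- 1) ^ (card J + 1) * g J)
        = (- 1) ^ (i - 1) * (\<Sum>J\<in>{J. J \<subseteq> F \<and> card J = i}. g J)"
      by (simp add: sum_distrib_left)
  qed
  finally show ?thesis by simp
qed

theorem theorem1:
  fixes M :: "'a measure"
    and Q :: "'i::countable \<Rightarrow> 'i \<Rightarrow> real"
    and \<rho> :: "'i \<Rightarrow> real"
    and X :: "nat \<Rightarrow> real \<Rightarrow> 'a \<Rightarrow> 'i"
    and U :: "'i set"
    and m :: real
  assumes "prob_space M"
    and "is_generator Q"
    and "bdd_above (range (\<lambda>i. \<bar>Q i i\<bar>))"
    and "\<forall>i. \<rho> i \<ge> 0" and "(\<rho> has_sum 1) UNIV"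
    and "\<forall>n. is_ctmc M Q \<rho> (X n)"
    and "prob_space.indep_vars M (\<lambda>_. Pi\<^sub>M UNIV (\<lambda>_::real. count_space (UNIV::'i set)))
           (\<lambda>n \<omega>. (\<lambda>t. X n t \<omega>)) UNIV"
    and "finite U"
    and "\<not> U \<subseteq> supp \<rho>"
    and "\<forall>j\<in>U. \<exists>N\<ge>1. (\<integral>\<^sup>+\<omega>. fpt X N j \<omega> \<partial>M) < \<top>"
    and "m > 0"
  shows "((\<lambda>N. ennreal (real N powr (m / real (dd Q \<rho> U))) *
                (\<integral>\<^sup>+\<omega>. enn_powr (cover_time X U N \<omega>) m \<partial>M))
          \<longlongrightarrow> ennreal (Kconst Q \<rho> U m)) sequentially"
proof -
  obtain C where C: "\<And>i. \<bar>Q i i\<bar> \<le> C"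
    using assms(3) by (auto simp: bdd_above_def)
  interpret prob_space M by fact
  interpret searchers Q C \<rho> M X
    by unfold_locales (use assms C in auto)
  note U = \<open>finite U\<close>
  note fpt = \<open>\<forall>j\<in>U. \<exists>N\<ge>1. (\<integral>\<^sup>+\<omega>. fpt X N j \<omega> \<partial>M) < \<top>\<close>
  define d where "d = dd Q \<rho> U"
  have fin: "depth j \<noteq> \<infinity>" if "j \<in> U" for j using fpt that depth_finite by blast
  have "U \<noteq> {}" using assms(9) by auto
  \<comment> \<open>\<open>U\<close> is finite and nonempty, so the supremum is a maximum and
    inherits finiteness from the single depths.\<close>
  then have "Sup (depth ` U) \<in> depth ` U" using U by (simp add: Sup_enat_def)
  then have "Sup (depth ` U) \<noteq> \<infinity>" using fin by auto
  then have supd: "Sup (depth ` U) = enat d" by (auto simp: d_def dd_def)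
  have depth_le: "depth j \<le> enat d" if "j \<in> U" for j
    unfolding supd[symmetric] using that by (intro Sup_upper) auto
  have d: "0 < d"
  proof -
    obtain j where j: "j \<in> U" "j \<notin> supp \<rho>" using assms(9) by auto
    then have "depth j \<noteq> 0" by (simp add: dmin_eq_0_iff)
    with depth_le[OF j(1)] show ?thesis by (cases d) (auto simp: zero_enat_def[symmetric])
  qed
  define p where "p = m / real d"
  have p: "0 < p" using d \<open>m > 0\<close> by (simp add: p_def)
  define F where "F = far Q \<rho> U"
  have F: "F = {j\<in>U. depth j = enat d}" by (simp add: F_def far_def d_def)
  define \<U> where "\<U> = {J. J \<subseteq> U \<and> J \<noteq> {}}"
  have fin_\<U>: "finite \<U>" using U by (simp add: \<U>_def)
  define f where "f = (\<lambda>J N u. indicator {0<..} u * (p * u powr (p - 1) * miss J (u powr (1 / real d)) ^ N))"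
  define L where "L = (\<lambda>J. if \<forall>j\<in>J. depth j = enat d then Gamma (1 + p) * (fact d / Lambda Q \<rho> J) powr p else 0)"
  have int: "\<forall>\<^sub>F N in sequentially. integrable lborel (f J N)"
    and lim: "(\<lambda>N. real N powr p * (\<integral>u. f J N u \<partial>lborel)) \<longlonglongrightarrow> L J" if "J \<in> \<U>" for J
  proof -
    have J: "finite J" "J \<noteq> {}" "\<forall>j\<in>J. \<exists>N\<ge>1. (\<integral>\<^sup>+\<omega>. fpt X N j \<omega> \<partial>M) < \<top>" "\<And>j. j \<in> J \<Longrightarrow> depth j \<le> enat d"
      using that U fpt depth_le by (auto simp: \<U>_def intro: finite_subset)
    show "\<forall>\<^sub>F N in sequentially. integrable lborel (f J N)"
      unfolding f_def by (rule miss_moment(1)[OF J(1-3) d J(4) p])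
    show "(\<lambda>N. real N powr p * (\<integral>u. f J N u \<partial>lborel)) \<longlonglongrightarrow> L J"
      unfolding f_def L_def by (rule miss_moment(2)[OF J(1-3) d J(4) p])
  qed
  have all_int: "\<forall>\<^sub>F N in sequentially. \<forall>J\<in>\<U>. integrable lborel (f J N)"
    using fin_\<U> int by (intro eventually_ball_finite) auto
  \<comment> \<open>The nonnegative total is first turned into a real integral and only then split
    into signed terms; this is valid once all terms are integrable, hence the restriction to large
    \<open>N\<close>.\<close>
  have ev: "\<forall>\<^sub>F N in sequentially.
      ennreal (\<Sum>J\<in>\<U>. (- 1) ^ (card J + 1) * (real N powr p * (\<integral>u. f J N u \<partial>lborel)))
      = ennreal (real N powr p) * (\<integral>\<^sup>+\<omega>. enn_powr (cover_time X U N \<omega>) m \<partial>M)"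
    using all_int
  proof eventually_elim
    case (elim N)
    let ?g = "\<lambda>u. indicator {0<..} u * (p * u powr (p - 1)) *
       prob {\<omega>\<in>space M. ennreal (u powr (1 / real d)) < cover_time X U N \<omega>}"
    have g: "?g u = (\<Sum>J\<in>\<U>. (- 1) ^ (card J + 1) * f J N u)" for u
      unfolding prob_not_covered[OF powr_ge_zero U] f_def \<U>_def
      by (simp add: sum_distrib_left mult_ac)
    have "(\<integral>\<^sup>+\<omega>. enn_powr (cover_time X U N \<omega>) m \<partial>M) = (\<integral>\<^sup>+u. ennreal (?g u) \<partial>lborel)"
      by (rule cover_moment_eq[OF d \<open>m > 0\<close> p_def U])
    also have "\<dots> = ennreal (\<integral>u. ?g u \<partial>lborel)"
    proof (rule nn_integral_eq_integral)
      show "integrable lborel ?g" unfolding g using elim by auto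
      show "AE u in lborel. 0 \<le> ?g u" using p by auto
    qed
    also have "(\<integral>u. ?g u \<partial>lborel) = (\<Sum>J\<in>\<U>. (- 1) ^ (card J + 1) * (\<integral>u. f J N u \<partial>lborel))"
      unfolding g using elim by (subst Bochner_Integration.integral_sum) auto
    finally show ?case
      by (simp add: ennreal_mult'[symmetric] sum_distrib_left mult_ac)
  qed
  have "(\<lambda>N. \<Sum>J\<in>\<U>. (- 1) ^ (card J + 1) * (real N powr p * (\<integral>u. f J N u \<partial>lborel)))
      \<longlonglongrightarrow> (\<Sum>J\<in>\<U>. (- 1) ^ (card J + 1) * L J)"
    by (intro tendsto_sum tendsto_mult tendsto_const lim)
  also have "(\<Sum>J\<in>\<U>. (- 1) ^ (card J + 1) * L J) = Kconst Q \<rho> U m"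
  proof -
    have "(\<Sum>J\<in>\<U>. (- 1) ^ (card J + 1) * L J)
        = (\<Sum>J | J \<subseteq> F \<and> J \<noteq> {}. (- 1) ^ (card J + 1) * (Gamma (1 + p) * (fact d / Lambda Q \<rho> J) powr p))"
      \<comment> \<open>A set containing a target nearer than \<open>d\<close> has limit 0, so only
        the subsets of \<open>F\<close> survive.\<close>
      by (rule sum.mono_neutral_cong_right) (use fin_\<U> in \<open>auto simp: \<U>_def F L_def\<close>)
    also have "\<dots> = Gamma (1 + p) * (\<Sum>J | J \<subseteq> F \<and> J \<noteq> {}. (- 1) ^ (card J + 1) * (fact d / Lambda Q \<rho> J) powr p)"
      by (simp add: sum_distrib_left mult_ac)
    also have "\<dots> = Kconst Q \<rho> U m"
    proof -
      have "finite F" using U F by simp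
      from sum_nonempty_subsets_by_card[OF this, of "\<lambda>J. (fact d / Lambda Q \<rho> J) powr p"]
      show ?thesis by (simp add: Kconst_def Let_def d_def[symmetric] F_def[symmetric] p_def[symmetric])
    qed
    finally show ?thesis .
  qed
  finally have "(\<lambda>N. ennreal (\<Sum>J\<in>\<U>. (- 1) ^ (card J + 1) * (real N powr p * (\<integral>u. f J N u \<partial>lborel))))
      \<longlonglongrightarrow> ennreal (Kconst Q \<rho> U m)"
    by (rule tendsto_ennrealI)
  from Lim_transform_eventually[OF this ev] show ?thesis
    by (simp only: p_def d_def)
qed

end
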